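(* Let $J\in C^2(\mathbb R^n;\mathbb R)$, and consider the system $$\dot x=\sum_{i=1}^n\Big(F_{1i}(J(x))u_{1i}(t)+F_{2i}(J(x))u_{2i}(t)\Big)e_i,\qquad x\in\mathbb R^n, \tag{P}$$ where $e_i$ is the $i$-th unit vector of $\mathbb R^n$. Suppose that for each $i=1,\dots,n$ the functions $F_{1i},F_{2i}\in C^1(\mathbb R;\mathbb R)$ satisfy $$F_{2i}(z)=-F_{1i}(z)\int\frac{F_{0i}(z)}{F_{1i}(z)^2}\,dz$$ (in the sense explained in the context) with some $F_{0i}:\mathbb R\to\mathbb R$. Let $u_{si}(t)=\sqrt\omega\,\tilde u_{si}(\omega t)$, $s=1,2$, $i=1,\dots,n$, $\omega>0$, where the $\tilde u_{si}$ are continuous $T$-periodic functions ($T>0$) with $\int_0^T\tilde u_{si}(\tau)\,d\tau=0$, and let $\beta_{si,pj}\in\mathbb R$ be defined by $$\int_0^T\int_0^\theta\tilde u_{si}(\theta)\tilde u_{pj}(\tau)\,d\tau\,d\theta=\beta_{si,pj}T,\qquad s,p\in\{1,2\},\ i,j\in\{1,\dots,n\}.$$ Then the Lie bracket system for (P) has the form $$\dot{\bar x}=-\sum_{i=1}^n\beta_{2i,1i}\frac{\partial J(\bar x)}{\partial\bar x_i}F_{0i}(J(\bar x))\,e_i.\tag{G}$$ Moreover, if $F_{1i},F_{2i}\in C^2(\mathbb R;\mathbb R)$ and a compact set $S\subset\mathbb R^n$ is locally (respectively, globally) uniformly asymptotically stable for (G), then $S$ is locally (respectively, semi-globally) practically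 uniformly asymptotically stable for (P).
   Context: Notation: for maps $f,g:\mathbb R^n\to\mathbb R^n$, $L_gf(x)=\lim_{s\to0}\frac{f(x+sg(x))-f(x)}{s}$ and $[f,g](x)=L_fg(x)-L_gf(x)$. $B_\delta(S)$ is the $\delta$-neighborhood of $S$. Lie bracket system: for $\dot x=f_0(x)+\sum_{j=1}^\ell f_j(x)\sqrt\omega\,v_j(\omega t)$ with continuous $T$-periodic zero-mean inputs $v_j$ and $\beta_{i,j}=\frac1T\int_0^T\int_0^\theta v_i(\theta)v_j(\tau)\,d\tau\,d\theta$, the associated Lie bracket system is $\dot{\bar x}=f_0(\bar x)+\sum_{i<j}\beta_{j,i}[f_i,f_j](\bar x)$. For (P), the vector fields are $F_{si}(J(x))e_i$, the inputs are $\tilde u_{si}$, and $f_0=0$. Meaning of the integral relation: $F_{1i}(z)\neq0$ except for at most a countable set $Z^*$ of isolated zeros. $\Psi(z)=\int\frac{F_{0i}(z)}{F_{1i}(z)^2}dz$ is an antiderivative of $F_{0i}/F_{1i}^2$ on $\mathbb R\setminus Z^*$; the relation means $F_{2i}(z)=-F_{1i}(z)\Psi(z)$ for $z\notin Z^*$ and $F_{2i}(z^* )=-\lim_{z\to z^*}F_{1i}(z)\Psi(z)$ for $z^*\in Z^*$. Practical stability (for a system depending on the parameter $\omega$, with initial condition $x(t_0)=x^0$): a compact set $S$ is locally practically uniformly asymptotically stable if (i) it is practically uniformly stable: for every $\varepsilon>0$ there exist $\delta>0$ and $\omega_0>0$ such that for all $t_0\ge0$ and $\omega>\omega_0$, if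 $x^0\in B_\delta(S)$ then the corresponding solution satisfies $x(t)\in B_\varepsilon(S)$ for all $t\ge t_0$; and (ii) it is $\hat\delta$-practically uniformly attractive for some $\hat\delta>0$: for every $\varepsilon>0$ there exist $t_1\ge0$ and $\omega_0>0$ such that for all $t_0\ge0$ and $\omega>\omega_0$, if $x^0\in B_{\hat\delta}(S)$ then the corresponding solution satisfies $x(t)\in B_\varepsilon(S)$ for all $t\ge t_0+t_1$. If (i) holds and (ii) holds for every $\hat\delta>0$, then $S$ is called semi-globally practically uniformly asymptotically stable.
   Formalization: Two conditions are added, without which the claim is false: β_{si,pj}=0 whenever i≠j (inputs of different coordinates are uncorrelated), and F_{0i} is continuous at each zero of F_{1i} (its value there is otherwise not fixed by the integral relation). *)

theory Defs
  imports "HOL-Analysis.Analysis"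
begin

definition C1_map :: "('a::real_normed_vector \<Rightarrow> 'b::real_normed_vector) \<Rightarrow> bool" where
  "C1_map f \<longleftrightarrow>
     (\<exists>f' :: 'a \<Rightarrow> 'a \<Rightarrow>\<^sub>L 'b.
        (\<forall>x. (f has_derivative blinfun_apply (f' x)) (at x)) \<and> continuous_on UNIV f')"

definition C2_map :: "('a::real_normed_vector \<Rightarrow> 'b::real_normed_vector) \<Rightarrow> bool" where
  "C2_map f \<longleftrightarrow>
     (\<exists>f' :: 'a \<Rightarrow> 'a \<Rightarrow>\<^sub>L 'b.
        (\<forall>x. (f has_derivative blinfun_apply (f' x)) (at x)) \<and> C1_map f')"

definition partial_deriv :: "'n \<Rightarrow> (real^'n \<Rightarrow> real) \<Rightarrow> real^'n \<Rightarrow> real" where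
  "partial_deriv i J x = deriv (\<lambda>s. J (x + s *\<^sub>R axis i 1)) 0"

definition lie_derivative ::
  "('a::real_normed_vector \<Rightarrow> 'a) \<Rightarrow> ('a \<Rightarrow> 'a) \<Rightarrow> 'a \<Rightarrow> 'a" where
  "lie_derivative g f x = Lim (at 0) (\<lambda>s. (f (x + s *\<^sub>R g x) - f x) /\<^sub>R s)"

definition lie_bracket ::
  "('a::real_normed_vector \<Rightarrow> 'a) \<Rightarrow> ('a \<Rightarrow> 'a) \<Rightarrow> 'a \<Rightarrow> 'a" where
  "lie_bracket f g x = lie_derivative f g x - lie_derivative g f x"

(* input_correlation T (v i) (v j) is the coefficient beta_{i,j} *)
definition input_correlation :: "real \<Rightarrow> (real \<Rightarrow> real) \<Rightarrow> (real \<Rightarrow> real) \<Rightarrow> real" where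
  "input_correlation T v w =
     1 / T * integral {0..T} (\<lambda>\<theta>. integral {0..\<theta>} (\<lambda>\<tau>. v \<theta> * w \<tau>))"

(* Right-hand side of the Lie bracket system of
   x' = f0(x) + sum_{j=1..l} f_j(x) sqrt(omega) v_j(omega t).  Differential equations are
   represented throughout by their right-hand sides. *)
definition lie_bracket_system ::
  "real \<Rightarrow> nat \<Rightarrow> ('a::real_normed_vector \<Rightarrow> 'a) \<Rightarrow> (nat \<Rightarrow> 'a \<Rightarrow> 'a) \<Rightarrow>
     (nat \<Rightarrow> real \<Rightarrow> real) \<Rightarrow> 'a \<Rightarrow> 'a" where
  "lie_bracket_system T l f0 f v x =
     f0 x + (\<Sum>j=1..l. \<Sum>i\<in>{1..<j}.
       input_correlation T (v j) (v i) *\<^sub>R lie_bracket (f i) (f j) x)"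

(* F2 = - F1 * (antiderivative of F0 / F1^2), extended by its limit to the zeros of F1.
   The constant of integration may differ between the components of the complement of Z. *)
definition integral_relation ::
  "(real \<Rightarrow> real) \<Rightarrow> (real \<Rightarrow> real) \<Rightarrow> (real \<Rightarrow> real) \<Rightarrow> bool" where
  "integral_relation F0 F1 F2 \<longleftrightarrow>
     (let Z = {z. F1 z = 0} in
        countable Z \<and> discrete Z \<and>
        (\<exists>\<Psi>. (\<forall>z. z \<notin> Z \<longrightarrow> (\<Psi> has_real_derivative F0 z / (F1 z)\<^sup>2) (at z)) \<and>
             (\<forall>z. z \<notin> Z \<longrightarrow> F2 z = - F1 z * \<Psi> z) \<and>
             (\<forall>z\<in>Z. ((\<lambda>y. F1 y * \<Psi> y) \<longlongrightarrow> - F2 z) (at z))))"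

(* System (P) with inputs u_{si}(t) = sqrt(omega) * u s i (omega t), s = 1,2 *)
definition extremum_seeking_system ::
  "(real^'n \<Rightarrow> real) \<Rightarrow> (nat \<Rightarrow> 'n \<Rightarrow> real \<Rightarrow> real) \<Rightarrow> (nat \<Rightarrow> 'n \<Rightarrow> real \<Rightarrow> real) \<Rightarrow>
     real \<Rightarrow> real \<Rightarrow> real^'n \<Rightarrow> real^'n" where
  "extremum_seeking_system J F u \<omega> t x =
     (\<Sum>i\<in>UNIV. (F 1 i (J x) * (sqrt \<omega> * u 1 i (\<omega> * t)) +
                  F 2 i (J x) * (sqrt \<omega> * u 2 i (\<omega> * t))) *\<^sub>R axis i 1)"

(* System (G); gain i stands for beta_{2i,1i} *)
definition gradient_like_system ::
  "(real^'n \<Rightarrow> real) \<Rightarrow> ('n \<Rightarrow> real \<Rightarrow> real) \<Rightarrow> ('n \<Rightarrow> real) \<Rightarrow> real^'n \<Rightarrow> real^'n" where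
  "gradient_like_system J F0 gain x =
     - (\<Sum>i\<in>UNIV. (gain i * partial_deriv i J x * F0 i (J x)) *\<^sub>R axis i 1)"

definition nbhd :: "real \<Rightarrow> 'a::metric_space set \<Rightarrow> 'a set" where
  "nbhd \<delta> S = (\<Union>y\<in>S. ball y \<delta>)"

definition is_solution ::
  "(real \<Rightarrow> 'a \<Rightarrow> 'a) \<Rightarrow> real \<Rightarrow> 'a \<Rightarrow> (real \<Rightarrow> 'a::real_normed_vector) \<Rightarrow> bool" where
  "is_solution f t0 x0 x \<longleftrightarrow>
     x t0 = x0 \<and> (\<forall>t\<ge>t0. (x has_vector_derivative f t (x t)) (at t within {t0..}))"

(* "The solution starting from x0 at time t0 satisfies x(t) in A for all t >= t1":
   this includes existence of a solution on the whole half-line. *)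
definition solution_stays ::
  "(real \<Rightarrow> 'a \<Rightarrow> 'a) \<Rightarrow> real \<Rightarrow> 'a::real_normed_vector \<Rightarrow> real \<Rightarrow> 'a set \<Rightarrow> bool" where
  "solution_stays f t0 x0 t1 A \<longleftrightarrow>
     (\<exists>x. is_solution f t0 x0 x) \<and> (\<forall>x. is_solution f t0 x0 x \<longrightarrow> (\<forall>t\<ge>t1. x t \<in> A))"

definition uniformly_stable ::
  "(real \<Rightarrow> 'a \<Rightarrow> 'a) \<Rightarrow> 'a::real_normed_vector set \<Rightarrow> bool" where
  "uniformly_stable f S \<longleftrightarrow>
     (\<forall>\<epsilon>>0. \<exists>\<delta>>0. \<forall>t0\<ge>0. \<forall>x0\<in>nbhd \<delta> S. solution_stays f t0 x0 t0 (nbhd \<epsilon> S))"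

definition uniformly_attractive ::
  "real \<Rightarrow> (real \<Rightarrow> 'a \<Rightarrow> 'a) \<Rightarrow> 'a::real_normed_vector set \<Rightarrow> bool" where
  "uniformly_attractive \<delta>h f S \<longleftrightarrow>
     (\<forall>\<epsilon>>0. \<exists>t1\<ge>0. \<forall>t0\<ge>0. \<forall>x0\<in>nbhd \<delta>h S.
        solution_stays f t0 x0 (t0 + t1) (nbhd \<epsilon> S))"

definition locally_uniformly_asymptotically_stable ::
  "(real \<Rightarrow> 'a \<Rightarrow> 'a) \<Rightarrow> 'a::real_normed_vector set \<Rightarrow> bool" where
  "locally_uniformly_asymptotically_stable f S \<longleftrightarrow>
     uniformly_stable f S \<and> (\<exists>\<delta>h>0. uniformly_attractive \<delta>h f S)"

definition globally_uniformly_asymptotically_stable ::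
  "(real \<Rightarrow> 'a \<Rightarrow> 'a) \<Rightarrow> 'a::real_normed_vector set \<Rightarrow> bool" where
  "globally_uniformly_asymptotically_stable f S \<longleftrightarrow>
     uniformly_stable f S \<and> (\<forall>\<delta>h>0. uniformly_attractive \<delta>h f S)"

(* In the practical notions the first argument of f is the parameter omega. *)
definition practically_uniformly_stable ::
  "(real \<Rightarrow> real \<Rightarrow> 'a \<Rightarrow> 'a) \<Rightarrow> 'a::real_normed_vector set \<Rightarrow> bool" where
  "practically_uniformly_stable f S \<longleftrightarrow>
     (\<forall>\<epsilon>>0. \<exists>\<delta>>0. \<exists>\<omega>0>0. \<forall>t0\<ge>0. \<forall>\<omega>>\<omega>0. \<forall>x0\<in>nbhd \<delta> S.
        solution_stays (f \<omega>) t0 x0 t0 (nbhd \<epsilon> S))"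

definition practically_uniformly_attractive ::
  "real \<Rightarrow> (real \<Rightarrow> real \<Rightarrow> 'a \<Rightarrow> 'a) \<Rightarrow> 'a::real_normed_vector set \<Rightarrow> bool" where
  "practically_uniformly_attractive \<delta>h f S \<longleftrightarrow>
     (\<forall>\<epsilon>>0. \<exists>t1\<ge>0. \<exists>\<omega>0>0. \<forall>t0\<ge>0. \<forall>\<omega>>\<omega>0. \<forall>x0\<in>nbhd \<delta>h S.
        solution_stays (f \<omega>) t0 x0 (t0 + t1) (nbhd \<epsilon> S))"

definition locally_practically_uniformly_asymptotically_stable ::
  "(real \<Rightarrow> real \<Rightarrow> 'a \<Rightarrow> 'a) \<Rightarrow> 'a::real_normed_vector set \<Rightarrow> bool" where
  "locally_practically_uniformly_asymptotically_stable f S \<longleftrightarrow>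
     practically_uniformly_stable f S \<and> (\<exists>\<delta>h>0. practically_uniformly_attractive \<delta>h f S)"

definition semiglobally_practically_uniformly_asymptotically_stable ::
  "(real \<Rightarrow> real \<Rightarrow> 'a \<Rightarrow> 'a) \<Rightarrow> 'a::real_normed_vector set \<Rightarrow> bool" where
  "semiglobally_practically_uniformly_asymptotically_stable f S \<longleftrightarrow>
     practically_uniformly_stable f S \<and> (\<forall>\<delta>h>0. practically_uniformly_attractive \<delta>h f S)"

end

theory Submission
  imports Defs
begin

text \<open>Let \<open>f k\<close> be the vector fields and \<open>v k\<close> the inputs of (P), \<open>V k\<close> the primitive of \<open>v k\<close>,
  \<open>g j k = D (f k) (f j)\<close>, and \<open>W j k\<close> the primitive of the mean-free function \<open>v j * V k - \<beta> j k\<close>.  The variable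
  \<open>z = x - \<omega>\<^sup>-\<^sup>1\<^sup>/\<^sup>2 * (\<Sum>k. V k (\<omega> t) * f k x) + \<omega>\<^sup>-\<^sup>1 * (\<Sum>j k. W j k (\<omega> t) * g j k x)\<close> is
  \<open>O(\<omega>\<^sup>-\<^sup>1\<^sup>/\<^sup>2)\<close>-close to \<open>x\<close> and satisfies \<open>z' = - (\<Sum>j k. \<beta> j k * g j k x) + O(\<omega>\<^sup>-\<^sup>1\<^sup>/\<^sup>2)\<close>.  Since \<open>\<beta>\<close> is
  antisymmetric, the leading term is the Lie bracket system.  Gronwall's inequality then keeps solutions of (P)
  close to solutions of (G) on bounded time intervals, uniformly in the initial time, and asymptotic stability
  of (G) allows one to concatenate these intervals.  The Lie brackets themselves come from the identity
  \<open>F0 = F1' * F2 - F2' * F1\<close>, which is the integral relation in differentiated form.\<close>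

section \<open>Ordinary differential equations\<close>

text \<open>A direct Gronwall estimate between solutions of (P) and (G) is useless: the right-hand
  side of (P) and its Lipschitz constants have size \<open>sqrt \<omega>\<close>, so the exponential
  blows up as \<omega> grows. For \<open>z\<close> only the Lipschitz constant of (G) on a ball
  stays in the exponent. The price is that the products \<open>D (f k) (f j)\<close> must be
  differentiated once more, which is where the C2 hypotheses enter. The practical notions include
  existence of solutions on the whole half-line, whereas (P) is only locally Lipschitz in the state.
  Solutions are therefore constructed for a truncated system, and the closeness to (G) shows
  afterwards that they stay where the truncation changes nothing.\<close>

lemma first_crossing:
  fixes h :: "real \<Rightarrow> real"
  assumes cont: "continuous_on {a..b} h" and start: "h a < 0"
    and step: "\<And>c. c \<in> {a..b} \<Longrightarrow> \<forall>s\<in>{a..c}. h s \<le> 0 \<Longrightarrow> h c < 0"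
    and t: "t \<in> {a..b}"
  shows "h t < 0"
proof (rule ccontr)
  assume neg: "\<not> h t < 0"
  let ?S = "{s \<in> {a..b}. 0 \<le> h s}"
  have "?S = {a..b} \<inter> h -` {0..}"
    by auto
  moreover have "closed ({a..b} \<inter> h -` {0..})"
    by (intro continuous_closed_preimage cont) auto
  ultimately have "closed ?S"
    by argo
  moreover have "bounded ?S"
    by (rule bounded_subset[of "{a..b}"]) auto
  ultimately have "compact ?S"
    by (simp add: compact_eq_bounded_closed)
  moreover have "?S \<noteq> {}"
    using neg t by auto
  ultimately have "\<exists>c\<in>?S. \<forall>s\<in>?S. c \<le> s"
    by (rule compact_attains_inf)
  then obtain c where c: "c \<in> ?S" "\<And>s. s \<in> ?S \<Longrightarrow> c \<le> s"
    by blast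
  have below: "h s < 0" if "s \<in> {a..<c}" for s
    using that c by force
  \<comment> \<open>The step hypothesis wants the weak inequality at \<open>c\<close> itself. The
    intermediate value theorem gives a zero \<open>d \<le> c\<close>, and minimality of
    \<open>c\<close> forces \<open>d = c\<close>.\<close>
  have "h c \<le> 0"
  proof -
    have "\<exists>d\<ge>a. d \<le> c \<and> h d = 0"
      using c(1) start by (intro IVT') (auto intro: continuous_on_subset[OF cont])
    then obtain d where "a \<le> d" "d \<le> c" "h d = 0"
      by blast
    with c below show ?thesis
      by (metis atLeastLessThan_iff less_irrefl order_le_less)
  qed
  then have "\<forall>s\<in>{a..c}. h s \<le> 0"
    using below by (metis atLeastAtMost_iff atLeastLessThan_iff less_eq_real_def)
  then have "h c < 0"
    using step c(1) by auto
  with c(1) show False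
    by simp
qed

lemma gronwall:
  fixes e :: "real \<Rightarrow> 'a::real_normed_vector"
  assumes der: "\<And>s. s \<in> {a..b} \<Longrightarrow> (e has_vector_derivative e' s) (at s within {a..b})"
    and bound: "\<And>s. s \<in> {a..b} \<Longrightarrow> norm (e' s) \<le> A + L * norm (e s)"
    and A: "A \<ge> 0" and L: "L \<ge> 0" and t: "t \<in> {a..b}"
  shows "norm (e t) \<le> (norm (e a) + A * (t - a)) * exp (L * (t - a))"
proof (rule field_le_epsilon)
  fix \<epsilon> :: real assume \<epsilon>: "\<epsilon> > 0"
  \<comment> \<open>The slack makes the initial inequality strict, as \<open>first_crossing\<close>
    needs, and is scaled to amount to exactly \<epsilon> at time \<open>t\<close>.\<close>
  define \<delta> where "\<delta> = \<epsilon> / exp (L * (t - a))"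
  have \<delta>: "\<delta> > 0"
    using \<epsilon> by (simp add: \<delta>_def)
  define m where "m s = (norm (e a) + \<delta> + A * (s - a)) * exp (L * (s - a))" for s
  have m_der: "(m has_vector_derivative A * exp (L * (s - a)) + L * m s) (at s)" for s
    unfolding m_def has_real_derivative_iff_has_vector_derivative[symmetric]
    by (auto intro!: derivative_eq_intros simp: algebra_simps)
  have e_cont: "continuous_on {a..b} e"
    by (rule continuous_on_vector_derivative) (rule der)
  have m_cont: "continuous_on X m" for X
    unfolding m_def by (intro continuous_intros)
  have "norm (e t) - m t < 0"
  proof (rule first_crossing[OF _ _ _ t])
    show "continuous_on {a..b} (\<lambda>s. norm (e s) - m s)"
      by (intro continuous_intros e_cont m_cont)
    show "norm (e a) - m a < 0"
      using \<delta> by (simp add: m_def)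
    fix c assume c: "c \<in> {a..b}" and le: "\<forall>s\<in>{a..c}. norm (e s) - m s \<le> 0"
    show "norm (e c) - m c < 0"
    proof (cases "c = a")
      case True
      then show ?thesis
        using \<delta> by (simp add: m_def)
    next
      case False
      then have "a < c"
        using c by auto
      then have "norm (e c - e a) \<le> m c - m a"
      proof (rule differentiable_bound_general)
        show "continuous_on {a..c} e"
          using e_cont c by (rule_tac continuous_on_subset) auto
        fix s assume s: "a < s" "s < c"
        then have "s \<in> interior {a..b}"
          using c by auto
        then show "(e has_vector_derivative e' s) (at s)"
          using der[of s] interior_subset by (metis at_within_interior subsetD)
        show "(m has_vector_derivative A * exp (L * (s - a)) + L * m s) (at s)"
          by (rule m_der)
        have "norm (e' s) \<le> A + L * norm (e s)"
          using bound s c by auto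
        also have "\<dots> \<le> A * exp (L * (s - a)) + L * m s"
          using le s L A by (intro add_mono mult_left_mono) (auto simp: mult_le_cancel_left1)
        finally show "norm (e' s) \<le> A * exp (L * (s - a)) + L * m s" .
      qed (rule m_cont)
      moreover have "norm (e c) \<le> norm (e c - e a) + norm (e a)"
        by (metis diff_add_cancel norm_triangle_ineq)
      ultimately show ?thesis
        using \<delta> by (simp add: m_def)
    qed
  qed
  then show "norm (e t) \<le> (norm (e a) + A * (t - a)) * exp (L * (t - a)) + \<epsilon>"
    by (simp add: m_def \<delta>_def algebra_simps)
qed

lemma integral_has_vector_derivative_half_line:
  fixes h :: "real \<Rightarrow> 'a::banach"
  assumes "continuous_on {a..} h" "t \<ge> a"
  shows "((\<lambda>t. integral {a..t} h) has_vector_derivative h t) (at t within {a..})"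
proof -
  have "((\<lambda>t. integral {a..t} h) has_vector_derivative h t) (at t within {a..t+1})"
    using assms by (intro integral_has_vector_derivative) (auto intro: continuous_on_subset)
  moreover have "at t within {a..} = at t within {a..t+1}"
    by (rule at_within_nhd[of _ "{..<t+1}"]) auto
  ultimately show ?thesis
    by simp
qed

lemma is_solution_derivative_on:
  assumes "is_solution f t0 x0 x" "t0 \<le> a" "t \<in> {a..b}"
  shows "(x has_vector_derivative f t (x t)) (at t within {a..b})"
proof (rule has_vector_derivative_within_subset)
  show "(x has_vector_derivative f t (x t)) (at t within {t0..})"
    using assms by (auto simp: is_solution_def)
qed (use assms in auto)

lemma is_solution_continuous_on:
  assumes "is_solution f t0 x0 x"
  shows "continuous_on {t0..} x"
  using assms unfolding is_solution_def by (auto intro!: continuous_on_vector_derivative)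

lemma is_solution_restart:
  assumes "is_solution f t0 x0 x" "t0 \<le> t1"
  shows "is_solution f t1 (x t1) x"
  using assms unfolding is_solution_def
  by (meson atLeast_subset_iff has_vector_derivative_within_subset order_trans)

lemma continuous_on_lipschitz_compose:
  fixes f :: "real \<Rightarrow> 'a::metric_space \<Rightarrow> 'b::metric_space"
  assumes cont: "\<And>x. continuous_on I (\<lambda>t. f t x)" and lip: "\<And>t. t \<in> I \<Longrightarrow> L-lipschitz_on UNIV (f t)"
    and x: "continuous_on I x"
  shows "continuous_on I (\<lambda>t. f t (x t))"
  unfolding continuous_on_def
proof
  fix t assume t: "t \<in> I"
  have "((\<lambda>s. L * dist (x s) (x t) + dist (f s (x t)) (f t (x t))) \<longlongrightarrow> L * dist (x t) (x t) + dist (f t (x t)) (f t (x t)))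
      (at t within I)"
    using x cont[of "x t"] t unfolding continuous_on_def by (intro tendsto_intros) auto
  then have lim: "((\<lambda>s. L * dist (x s) (x t) + dist (f s (x t)) (f t (x t))) \<longlongrightarrow> 0) (at t within I)"
    by simp
  have "norm (dist (f s (x s)) (f t (x t))) \<le> L * dist (x s) (x t) + dist (f s (x t)) (f t (x t))"
    if "s \<in> I" for s
    using dist_triangle[of "f s (x s)" "f t (x t)" "f s (x t)"] lipschitz_onD[OF lip[OF that], of "x s" "x t"] by simp
  then have "\<forall>\<^sub>F s in at t within I. norm (dist (f s (x s)) (f t (x t))) \<le> L * dist (x s) (x t) + dist (f s (x t)) (f t (x t))"
    unfolding eventually_at_filter by (intro always_eventually) blast
  then have "((\<lambda>s. dist (f s (x s)) (f t (x t))) \<longlongrightarrow> 0) (at t within I)"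
    using lim by (rule Lim_null_comparison)
  then show "((\<lambda>s. f s (x s)) \<longlongrightarrow> f t (x t)) (at t within I)"
    by (rule iffD2[OF tendsto_dist_iff])
qed

text \<open>The factor \<open>1 / c\<close> gained against the weight is the source of the
  contraction in the weighted Picard iteration.\<close>

lemma norm_integral_le_exp:
  fixes h :: "real \<Rightarrow> 'a::banach"
  assumes cont: "continuous_on {a..t} h" and bound: "\<And>s. s \<in> {a..t} \<Longrightarrow> norm (h s) \<le> K * exp (c * (s - a))"
    and "c > 0" "a \<le> t" "K \<ge> 0"
  shows "norm (integral {a..t} h) \<le> K / c * exp (c * (t - a))"
proof -
  have "((\<lambda>s. K * exp (c * (s - a))) has_integral K / c * exp (c * (t - a)) - K / c * exp (c * (a - a))) {a..t}"
    using \<open>c > 0\<close> \<open>a \<le> t\<close>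
    by (intro fundamental_theorem_of_calculus)
      (auto intro!: derivative_eq_intros simp: has_real_derivative_iff_has_vector_derivative[symmetric])
  then have "norm (integral {a..t} h) \<le> K / c * exp (c * (t - a)) - K / c"
    using integral_norm_bound_integral[of h "{a..t}" "\<lambda>s. K * exp (c * (s - a))"] bound
    by (simp add: has_integral_iff integrable_continuous_real[OF cont])
  also have "\<dots> \<le> K / c * exp (c * (t - a))"
    using assms by simp
  finally show ?thesis .
qed

text \<open>Solutions \<open>x\<close> are sought in the form \<open>x t = exp (c * (t - t0)) *\<^sub>R w t\<close> with \<open>w\<close> bounded; for
  \<open>c\<close> large compared with \<open>L\<close> the integral equation is a contraction in \<open>w\<close>.\<close>

lemma picard_global:
  fixes f :: "real \<Rightarrow> 'a::banach \<Rightarrow> 'a"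
  assumes cont: "\<And>x. continuous_on {t0..} (\<lambda>t. f t x)"
    and lip: "\<And>t. t \<ge> t0 \<Longrightarrow> L-lipschitz_on UNIV (f t)"
    and bounded: "\<And>t. t \<ge> t0 \<Longrightarrow> norm (f t 0) \<le> M"
  shows "\<exists>x. is_solution f t0 x0 x"
proof -
  have L: "L \<ge> 0"
    using lip[of t0] lipschitz_on_nonneg by auto
  have M: "M \<ge> 0"
    using bounded[of t0] norm_ge_zero order_trans by blast
  \<comment> \<open>Twice \<open>L\<close> yields the contraction factor 1/2; the added 1 keeps
    \<open>c\<close> positive when \<open>L = 0\<close>.\<close>
  define c where "c = 2 * L + 1"
  have c: "c > 0" "L / c \<le> 1 / 2"
    using L by (auto simp: c_def field_simps)
  define h where "h w s = f s (exp (c * (s - t0)) *\<^sub>R apply_bcontfun w s)" for w s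
  have h_cont: "continuous_on {t0..} (h w)" for w
    unfolding h_def by (intro continuous_on_lipschitz_compose[OF cont, of L] lip) (auto intro!: continuous_intros)
  have f_bound: "norm (f s x) \<le> M + L * norm x" if "s \<ge> t0" for s x
  proof -
    have "norm (f s x) \<le> norm (f s 0) + norm (f s x - f s 0)"
      by (metis add_diff_cancel_left' add.commute diff_add_cancel norm_triangle_ineq)
    also have "\<dots> \<le> M + L * norm x"
      using lipschitz_onD[OF lip[OF that], of x 0] bounded[OF that] by (simp add: dist_norm)
    finally show ?thesis .
  qed
  have h_bound: "norm (h w s) \<le> (M + L * norm w) * exp (c * (s - t0))" if "s \<ge> t0" for w s
  proof -
    have "norm (h w s) \<le> M + L * (exp (c * (s - t0)) * norm w)"
      unfolding h_def using L
      by (intro order_trans[OF f_bound[OF that]]) (auto intro!: mult_left_mono norm_bounded)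
    also have "\<dots> \<le> M * exp (c * (s - t0)) + L * (exp (c * (s - t0)) * norm w)"
      using M c that by (auto simp: mult_le_cancel_left1)
    finally show ?thesis
      by (simp add: algebra_simps)
  qed
  define I where "I w t = integral {t0..t} (h w)" for w t
  \<comment> \<open>Dividing the integral equation by the weight gives this operator for
    \<open>w\<close>. Freezing time at \<open>t0\<close> to its left yields functions on the whole
    line, so that the fixed point theorem applies in the complete space of bounded continuous
    functions.\<close>
  define G where "G w t = exp (- c * (max t t0 - t0)) *\<^sub>R (x0 + I w (max t t0))" for w t
  have I_deriv: "(I w has_vector_derivative h w t) (at t within {t0..})" if "t \<ge> t0" for w t
    unfolding I_def by (rule integral_has_vector_derivative_half_line[OF h_cont that])
  then have I_cont: "continuous_on {t0..} (I w)" for w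
    by (auto intro!: continuous_on_vector_derivative)
  have decay: "exp (- c * (t - t0)) * exp (c * (t - t0)) = 1" for t
    by (simp add: exp_minus)
  have G_bcontfun: "G w \<in> bcontfun" for w
  proof (rule bcontfun_normI)
    show "continuous_on UNIV (G w)"
      unfolding G_def
      by (intro continuous_intros continuous_on_compose2[OF I_cont]) auto
    fix t
    let ?t = "max t t0"
    have "norm (I w ?t) \<le> (M + L * norm w) / c * exp (c * (?t - t0))"
      unfolding I_def using c L M
      by (intro norm_integral_le_exp h_bound) (auto intro: continuous_on_subset[OF h_cont])
    then have "norm (G w t) \<le> exp (- c * (?t - t0)) * (norm x0 + (M + L * norm w) / c * exp (c * (?t - t0)))"
      unfolding G_def by (auto intro!: mult_left_mono norm_triangle_le)
    also have "\<dots> = exp (- c * (?t - t0)) * norm x0 + (M + L * norm w) / c"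
      using decay[of ?t] by (simp add: algebra_simps)
    also have "\<dots> \<le> norm x0 + (M + L * norm w) / c"
      using c by (auto intro!: mult_left_le_one_le)
    finally show "norm (G w t) \<le> norm x0 + (M + L * norm w) / c" .
  qed
  have G_apply: "apply_bcontfun (Bcontfun (G w)) = G w" for w
    using G_bcontfun Bcontfun_inverse by blast
  have contraction: "dist (Bcontfun (G v)) (Bcontfun (G w)) \<le> 1/2 * dist v w" for v w
  proof (rule dist_bound)
    fix t
    let ?t = "max t t0"
    have "norm (integral {t0..?t} (\<lambda>s. h v s - h w s)) \<le> (L * dist v w) / c * exp (c * (?t - t0))"
    proof (rule norm_integral_le_exp)
      show "continuous_on {t0..?t} (\<lambda>s. h v s - h w s)"
        by (intro continuous_intros) (auto intro: continuous_on_subset[OF h_cont])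
      fix s assume "s \<in> {t0..?t}"
      then have "norm (h v s - h w s) \<le> L * dist (exp (c * (s - t0)) *\<^sub>R v s) (exp (c * (s - t0)) *\<^sub>R w s)"
        unfolding h_def using lipschitz_onD[OF lip] by (metis UNIV_I atLeastAtMost_iff dist_norm)
      also have "\<dots> = L * (exp (c * (s - t0)) * dist (v s) (w s))"
        by (simp add: dist_norm flip: scaleR_diff_right)
      also have "\<dots> \<le> L * (exp (c * (s - t0)) * dist v w)"
        using L by (intro mult_left_mono dist_bounded) auto
      finally show "norm (h v s - h w s) \<le> L * dist v w * exp (c * (s - t0))"
        by (simp add: algebra_simps)
    qed (use c L in auto)
    also have "integral {t0..?t} (\<lambda>s. h v s - h w s) = I v ?t - I w ?t"
      unfolding I_def by (intro integral_diff integrable_continuous_real) (auto intro: continuous_on_subset[OF h_cont])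
    finally have "dist (G v t) (G w t) \<le> exp (- c * (?t - t0)) * ((L * dist v w) / c * exp (c * (?t - t0)))"
      unfolding G_def
      by (simp add: dist_norm flip: scaleR_diff_right del: times_divide_eq_right times_divide_eq_left)
    also have "\<dots> = L / c * dist v w"
      using decay[of ?t] by (simp add: algebra_simps)
    also have "\<dots> \<le> 1/2 * dist v w"
      using c by (intro mult_right_mono) auto
    finally show "dist (apply_bcontfun (Bcontfun (G v)) t) (apply_bcontfun (Bcontfun (G w)) t) \<le> 1/2 * dist v w"
      by (simp add: G_apply)
  qed
  obtain w where w: "Bcontfun (G w) = w"
    using banach_fix_type[of "1/2" "\<lambda>w. Bcontfun (G w)"] contraction by auto
  define x where "x t = exp (c * (t - t0)) *\<^sub>R apply_bcontfun w t" for t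
  have x_eq: "x t = x0 + I w t" if "t \<ge> t0" for t
  proof -
    have "apply_bcontfun w t = G w t"
      by (metis w G_apply)
    then show ?thesis
      using that decay[of t] by (simp add: x_def G_def max_def mult.commute)
  qed
  have "is_solution f t0 x0 x"
    unfolding is_solution_def
  proof (intro conjI allI impI)
    show "x t0 = x0"
      using x_eq[of t0] by (simp add: I_def)
    fix t assume t: "t \<ge> t0"
    have "((\<lambda>t. x0 + I w t) has_vector_derivative h w t) (at t within {t0..})"
      using I_deriv[OF t] by (auto intro!: derivative_eq_intros)
    then show "(x has_vector_derivative f t (x t)) (at t within {t0..})"
      unfolding h_def x_def[symmetric]
      by (rule has_vector_derivative_transform[rotated 2]) (use t x_eq in auto)
  qed
  then show ?thesis
    by (rule exI[of _ x])
qed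

text \<open>On \<open>{t0..t}\<close> both curves lie in a common ball by compactness, so local
  Lipschitz constants suffice for Gronwall with \<open>A = 0\<close>.\<close>

lemma is_solution_unique:
  fixes f :: "real \<Rightarrow> 'a::real_normed_vector \<Rightarrow> 'a"
  assumes lip: "\<And>R. \<exists>L. \<forall>t\<ge>t0. L-lipschitz_on (cball 0 R) (f t)"
    and x: "is_solution f t0 x0 x" and y: "is_solution f t0 x0 y" and t: "t \<ge> t0"
  shows "x t = y t"
proof -
  have "compact (x ` {t0..t} \<union> y ` {t0..t})"
    by (intro compact_Un compact_continuous_image continuous_on_subset[OF is_solution_continuous_on[OF x]]
      continuous_on_subset[OF is_solution_continuous_on[OF y]]) auto
  then obtain R where "\<forall>z \<in> x ` {t0..t} \<union> y ` {t0..t}. norm z \<le> R"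
    by (meson bounded_iff compact_imp_bounded)
  then have R: "x s \<in> cball 0 R \<and> y s \<in> cball 0 R" if "s \<in> {t0..t}" for s
    using that by auto
  obtain L where L: "\<forall>t\<ge>t0. L-lipschitz_on (cball 0 R) (f t)"
    using lip by blast
  have "norm (x t - y t) \<le> (norm (x t0 - y t0) + 0 * (t - t0)) * exp (L * (t - t0))"
  proof (rule gronwall[where b = t])
    fix s assume s: "s \<in> {t0..t}"
    show "((\<lambda>s. x s - y s) has_vector_derivative f s (x s) - f s (y s)) (at s within {t0..t})"
      using s by (intro has_vector_derivative_diff is_solution_derivative_on[OF x] is_solution_derivative_on[OF y]) auto
    show "norm (f s (x s) - f s (y s)) \<le> 0 + L * norm (x s - y s)"
      using lipschitz_on_normD[of L "cball 0 R" "f s"] L R s by auto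
  qed (use t L lipschitz_on_nonneg in auto)
  then show ?thesis
    using x y by (simp add: is_solution_def)
qed

section \<open>Practical stability of averaged systems\<close>

lemma nbhd_mono: "a \<le> b \<Longrightarrow> nbhd a S \<subseteq> nbhd b S"
  unfolding nbhd_def by force

lemma nbhd_triangle:
  assumes "y \<in> nbhd a S" "dist x y < b"
  shows "x \<in> nbhd (a + b) S"
proof -
  obtain s where "s \<in> S" "dist s y < a"
    using assms(1) by (auto simp: nbhd_def)
  moreover have "dist s x \<le> dist s y + dist x y"
    by (simp add: dist_commute dist_triangle2)
  ultimately show ?thesis
    using assms(2) by (force simp: nbhd_def)
qed

lemma bounded_nbhd:
  fixes S :: "'a::real_normed_vector set"
  assumes "bounded S"
  shows "bounded (nbhd d S)"
proof -
  obtain r where "\<And>s. s \<in> S \<Longrightarrow> norm s \<le> r"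
    using assms by (auto simp: bounded_iff)
  then have "norm x \<le> r + d" if "s \<in> S" "dist s x < d" for x s
    using that norm_triangle_sub[of x s] by (fastforce simp: dist_norm norm_minus_commute)
  then have "norm x \<le> r + d" if "x \<in> nbhd d S" for x
    using that by (auto simp: nbhd_def)
  then show ?thesis
    unfolding bounded_iff by blast
qed

lemma closure_nbhd_subset: "d < d' \<Longrightarrow> closure (nbhd d S) \<subseteq> nbhd d' S"
proof
  fix x assume "d < d'" "x \<in> closure (nbhd d S)"
  then obtain y where "y \<in> nbhd d S" "dist x y < d' - d"
    by (metis closure_approachable diff_gt_0_iff_gt dist_commute)
  then show "x \<in> nbhd d' S"
    using nbhd_triangle by fastforce
qed

text \<open>Makes bounds found at one initial time uniform in the initial time.\<close>

lemma is_solution_autonomous_shift: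
  assumes y: "is_solution (\<lambda>t. g) s x0 y"
  shows "is_solution (\<lambda>t. g) t0 x0 (\<lambda>t. y (t - t0 + s))"
  unfolding is_solution_def
proof (intro conjI allI impI)
  show "y (t0 - t0 + s) = x0"
    using y by (simp add: is_solution_def)
  fix t assume t: "t \<ge> t0"
  have "((\<lambda>t. t - t0 + s) has_vector_derivative 1) (at t within {t0..})"
    by (auto intro!: derivative_eq_intros)
  moreover have "(y has_vector_derivative g (y (t - t0 + s))) (at (t - t0 + s) within (\<lambda>t. t - t0 + s) ` {t0..})"
    by (rule has_vector_derivative_within_subset[of _ _ _ "{s..}"]) (use y t in \<open>auto simp: is_solution_def\<close>)
  ultimately show "((\<lambda>t. y (t - t0 + s)) has_vector_derivative g (y (t - t0 + s))) (at t within {t0..})"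
    using vector_diff_chain_within[of "\<lambda>t. t - t0 + s" 1 t "{t0..}" y] by (simp add: o_def)
qed

text \<open>The hypotheses on \<open>z\<close> are only required while \<open>x\<close> stays in the ball where \<open>G\<close> is known to be
  Lipschitz; the first crossing argument keeps it there.\<close>

lemma near_solutions_close:
  fixes x y z :: "real \<Rightarrow> 'a::real_normed_vector"
  assumes lip: "L-lipschitz_on (cball 0 (R + 1)) G"
    and y: "\<And>t. t \<in> {a..b} \<Longrightarrow> (y has_vector_derivative G (y t)) (at t within {a..b})"
    and y_bound: "\<And>t. t \<in> {a..b} \<Longrightarrow> norm (y t) \<le> R"
    and x: "continuous_on {a..b} x"
    and zx: "\<And>t. t \<in> {a..b} \<Longrightarrow> norm (x t) \<le> R + 1 \<Longrightarrow> norm (z t - x t) \<le> \<kappa>"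
    and z: "\<And>t. t \<in> {a..b} \<Longrightarrow> norm (x t) \<le> R + 1 \<Longrightarrow>
      \<exists>d. (z has_vector_derivative d) (at t within {a..b}) \<and> norm (d - G (x t)) \<le> \<kappa>"
    and init: "norm (x a - y a) \<le> \<kappa>"
    and small: "\<kappa> * (1 + (2 + (1 + L) * (b - a)) * exp (L * (b - a))) < \<eta>" and \<eta>: "\<eta> \<le> 1"
    and t: "t \<in> {a..b}"
  shows "norm (x t - y t) < \<eta>"
proof -
  have ab: "a \<le> b"
    using t by auto
  have \<kappa>: "0 \<le> \<kappa>"
    using init norm_ge_zero order_trans by blast
  have L: "0 \<le> L"
    using lip by (rule lipschitz_on_nonneg)
  have y_cont: "continuous_on {a..b} y"
    by (rule continuous_on_vector_derivative) (rule y)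
  have "norm (x t - y t) - \<eta> < 0"
  proof (rule first_crossing[OF _ _ _ t])
    show "continuous_on {a..b} (\<lambda>t. norm (x t - y t) - \<eta>)"
      by (intro continuous_intros x y_cont)
    have "\<kappa> * 1 \<le> \<kappa> * (1 + (2 + (1 + L) * (b - a)) * exp (L * (b - a)))"
      using ab L \<kappa> by (intro mult_left_mono) auto
    then show "norm (x a - y a) - \<eta> < 0"
      using init small by linarith
    fix c assume c: "c \<in> {a..b}" and le: "\<forall>s\<in>{a..c}. norm (x s - y s) - \<eta> \<le> 0"
    have x_bound: "norm (x s) \<le> R + 1" if "s \<in> {a..c}" for s
      using that c le \<eta> y_bound[of s] norm_triangle_sub[of "x s" "y s"] by fastforce
    have "\<exists>d. (z has_vector_derivative d) (at s within {a..b}) \<and> norm (d - G (x s)) \<le> \<kappa>" if "s \<in> {a..c}" for s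
      using z x_bound that c by auto
    then obtain d where
      d: "\<And>s. s \<in> {a..c} \<Longrightarrow> (z has_vector_derivative d s) (at s within {a..b})"
        "\<And>s. s \<in> {a..c} \<Longrightarrow> norm (d s - G (x s)) \<le> \<kappa>"
      by metis
    have zx_c: "norm (z s - x s) \<le> \<kappa>" if "s \<in> {a..c}" for s
      using zx x_bound that c by auto
    \<comment> \<open>Gronwall acts on \<open>z - y\<close>, because it is \<open>z\<close> whose
      derivative is close to \<open>G (x s)\<close>. The error \<open>(1 + L) * \<kappa>\<close>
      collects the defect of that derivative and the Lipschitz cost of the gap between
      \<open>x\<close> and \<open>z\<close>.\<close>
    have "norm (z c - y c) \<le> (norm (z a - y a) + (1 + L) * \<kappa> * (c - a)) * exp (L * (c - a))"
    proof (rule gronwall[where b = c])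
      fix s assume s: "s \<in> {a..c}"
      show "((\<lambda>s. z s - y s) has_vector_derivative d s - G (y s)) (at s within {a..c})"
        using s c
        by (intro has_vector_derivative_diff has_vector_derivative_within_subset[OF d(1)]
          has_vector_derivative_within_subset[OF y]) auto
      have "norm (G (x s) - G (y s)) \<le> L * norm (x s - y s)"
        using s c x_bound y_bound[of s] by (intro lipschitz_on_normD[OF lip]) auto
      also have "\<dots> \<le> L * (norm (z s - y s) + \<kappa>)"
        using L zx_c[OF s] norm_triangle_ineq4[of "z s - y s" "z s - x s"] by (intro mult_left_mono) auto
      finally have "norm (G (x s) - G (y s)) \<le> L * (norm (z s - y s) + \<kappa>)" .
      then show "norm (d s - G (y s)) \<le> (1 + L) * \<kappa> + L * norm (z s - y s)"
        using d(2)[OF s] norm_triangle_ineq[of "d s - G (x s)" "G (x s) - G (y s)"] by (simp add: algebra_simps)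
    qed (use L \<kappa> c in auto)
    also have "\<dots> \<le> (2 * \<kappa> + (1 + L) * \<kappa> * (b - a)) * exp (L * (b - a))"
    proof (intro mult_mono add_mono mult_left_mono)
      show "norm (z a - y a) \<le> 2 * \<kappa>"
        using zx_c[of a] init c norm_triangle_ineq[of "z a - x a" "x a - y a"] by auto
    qed (use L \<kappa> c in \<open>auto intro!: mult_left_mono\<close>)
    finally have "norm (z c - y c) \<le> \<kappa> * ((2 + (1 + L) * (b - a)) * exp (L * (b - a)))"
      by (simp add: algebra_simps)
    \<comment> \<open>Returning from \<open>z\<close> to \<open>x\<close> costs another \<kappa>:
      the summand 1 in the smallness condition.\<close>
    then show "norm (x c - y c) - \<eta> < 0"
      using small zx_c[of c] c norm_triangle_ineq4[of "z c - y c" "z c - x c"] by (simp add: algebra_simps)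
  qed
  then show ?thesis
    by simp
qed

text \<open>Composing with the projection onto a ball turns a locally Lipschitz right-hand side into a
  globally Lipschitz one without changing the solutions that stay in the ball.\<close>

definition truncate :: "real \<Rightarrow> (real \<Rightarrow> 'a \<Rightarrow> 'a) \<Rightarrow> real \<Rightarrow> 'a::euclidean_space \<Rightarrow> 'a" where
  "truncate R f t x = f t (closest_point (cball 0 R) x)"

lemma truncate_eq: "norm x \<le> R \<Longrightarrow> truncate R f t x = f t x"
  by (simp add: truncate_def closest_point_self)

text \<open>\<open>Z\<close> is the displacement, so the change of variables is
  \<open>x + Z t x\<close>. The second clause assumes the equation only at the single time
  \<open>t\<close>; it can thus be applied to a truncated solution at those times when it lies in
  the ball.\<close>

definition near_identity_map ::
  "(real \<Rightarrow> 'a \<Rightarrow> 'a) \<Rightarrow> ('a \<Rightarrow> 'a) \<Rightarrow> real \<Rightarrow> real \<Rightarrow> (real \<Rightarrow> 'a \<Rightarrow> 'a::real_normed_vector) \<Rightarrow> bool" where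
  "near_identity_map f g R \<kappa> Z \<longleftrightarrow>
     (\<forall>t\<ge>0. \<forall>x. norm x \<le> R \<longrightarrow> norm (Z t x) \<le> \<kappa>) \<and>
     (\<forall>a\<ge>0. \<forall>t\<ge>a. \<forall>x. norm (x t) \<le> R \<longrightarrow>
        (x has_vector_derivative f t (x t)) (at t within {a..}) \<longrightarrow>
        (\<exists>d. ((\<lambda>s. x s + Z s (x s)) has_vector_derivative d) (at t within {a..}) \<and>
          norm (d - g (x t)) \<le> \<kappa>))"

text \<open>Only \<open>C\<close> has to be uniform in \<omega>. The Lipschitz constants of
  \<open>P \<omega>\<close> may grow with \<omega>, as they serve existence and uniqueness at fixed
  \<omega>.\<close>

locale averaging =
  fixes P :: "real \<Rightarrow> real \<Rightarrow> 'a::euclidean_space \<Rightarrow> 'a" and G :: "'a \<Rightarrow> 'a"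
  assumes G_lipschitz: "\<And>R. \<exists>L. L-lipschitz_on (cball 0 R) G"
    and P_continuous: "\<And>\<omega> x. \<omega> > 0 \<Longrightarrow> continuous_on {0..} (\<lambda>t. P \<omega> t x)"
    and P_lipschitz: "\<And>\<omega> R. \<omega> > 0 \<Longrightarrow> \<exists>L. \<forall>t\<ge>0. L-lipschitz_on (cball 0 R) (P \<omega> t)"
    and P_bounded: "\<And>\<omega>. \<omega> > 0 \<Longrightarrow> \<exists>M. \<forall>t\<ge>0. norm (P \<omega> t 0) \<le> M"
    and near_identity: "\<And>R. \<exists>C. \<forall>\<omega>\<ge>1. \<exists>Z. near_identity_map (P \<omega>) G R (C / sqrt \<omega>) Z"
begin

lemma truncated_solution_exists:
  assumes "\<omega> > 0" "t0 \<ge> 0" "R \<ge> 0"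
  shows "\<exists>x. is_solution (truncate R (P \<omega>)) t0 x0 x"
proof -
  obtain L where L: "\<forall>t\<ge>0. L-lipschitz_on (cball 0 R) (P \<omega> t)"
    using P_lipschitz assms(1) by blast
  obtain M where M: "\<forall>t\<ge>0. norm (P \<omega> t 0) \<le> M"
    using P_bounded assms(1) by blast
  let ?p = "closest_point (cball 0 R) :: 'a \<Rightarrow> 'a"
  have p: "?p x \<in> cball 0 R" for x
    using assms(3) by (intro closest_point_in_set) auto
  show ?thesis
  proof (rule picard_global)
    show "continuous_on {t0..} (\<lambda>t. truncate R (P \<omega>) t x)" for x
      unfolding truncate_def
      by (rule continuous_on_subset[OF P_continuous[OF assms(1)]]) (use assms(2) in auto)
    fix t assume t: "t \<ge> t0"
    show "norm (truncate R (P \<omega>) t 0) \<le> M"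
      using M t assms by (simp add: truncate_eq)
    show "L-lipschitz_on UNIV (truncate R (P \<omega>) t)"
    proof (rule lipschitz_onI)
      have lip: "L-lipschitz_on (cball 0 R) (P \<omega> t)"
        using L t assms by auto
      then show "L \<ge> 0"
        by (rule lipschitz_on_nonneg)
      fix x y
      have "dist (truncate R (P \<omega>) t x) (truncate R (P \<omega>) t y) \<le> L * dist (?p x) (?p y)"
        unfolding truncate_def by (rule lipschitz_onD[OF lip p p])
      also have "\<dots> \<le> L * dist x y"
        using \<open>L \<ge> 0\<close> assms(3) by (intro mult_left_mono closest_point_lipschitz) auto
      finally show "dist (truncate R (P \<omega>) t x) (truncate R (P \<omega>) t y) \<le> L * dist x y" .
    qed
  qed
qed

text \<open>A truncated solution that stays in the ball solves the original equation, and uniqueness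
  extends the claim to every solution, as the universal clause of \<open>solution_stays\<close>
  requires.\<close>

lemma solution_stays_of_truncated:
  assumes x: "is_solution (truncate R (P \<omega>)) t0 x0 x" and "\<omega> > 0" "t0 \<ge> 0" "t1 \<ge> t0"
    and bound: "\<And>t. t \<ge> t0 \<Longrightarrow> norm (x t) \<le> R" and A: "\<And>t. t \<ge> t1 \<Longrightarrow> x t \<in> A"
  shows "solution_stays (P \<omega>) t0 x0 t1 A"
proof -
  have sol: "is_solution (P \<omega>) t0 x0 x"
    using x bound unfolding is_solution_def by (simp add: truncate_eq)
  have "x' t = x t" if "is_solution (P \<omega>) t0 x0 x'" "t \<ge> t0" for x' t
  proof (rule is_solution_unique[OF _ that(1) sol that(2)])
    show "\<exists>L. \<forall>t\<ge>t0. L-lipschitz_on (cball 0 R) (P \<omega> t)" for R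
      using P_lipschitz[OF \<open>\<omega> > 0\<close>] \<open>t0 \<ge> 0\<close> by (meson order_trans)
  qed
  then show ?thesis
    unfolding solution_stays_def using sol A \<open>t1 \<ge> t0\<close> by (metis order_trans)
qed

text \<open>The near-identity bounds hold for all nonnegative times and all states in the ball,
  hence one threshold serves all \<open>t0\<close> and \<open>x0\<close>.\<close>

lemma finite_horizon_close:
  assumes "0 < \<eta>" "\<eta> \<le> 1" "D \<ge> 0"
  shows "\<exists>\<omega>0>0. \<forall>\<omega>>\<omega>0. \<forall>t0\<ge>0. \<forall>x0 x y. is_solution (truncate (R + 1) (P \<omega>)) t0 x0 x \<longrightarrow>
    is_solution (\<lambda>t. G) t0 x0 y \<longrightarrow> (\<forall>t\<in>{t0..t0 + D}. norm (y t) \<le> R) \<longrightarrow>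
    (\<forall>t\<in>{t0..t0 + D}. norm (x t - y t) < \<eta>)"
proof -
  obtain L where lip: "L-lipschitz_on (cball 0 (R + 1)) G"
    using G_lipschitz by blast
  then have L: "L \<ge> 0"
    by (rule lipschitz_on_nonneg)
  obtain C where near: "\<forall>\<omega>\<ge>1. \<exists>Z. near_identity_map (P \<omega>) G (R + 1) (C / sqrt \<omega>) Z"
    using near_identity by blast
  define K where "K = 1 + (2 + (1 + L) * D) * exp (L * D)"
  have K: "K > 0"
    using L assms by (auto simp: K_def intro!: add_pos_nonneg)
  \<comment> \<open>Squaring solves \<open>\<bar>C\<bar> / sqrt \<omega> * K < \<eta>\<close> for
    \<omega>; the maximum with 1 keeps \<omega> in the range of the near-identity estimate.\<close>
  define \<omega>0 where "\<omega>0 = max 1 ((\<bar>C\<bar> * K / \<eta>)\<^sup>2)"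
  show ?thesis
  proof (rule exI[of _ \<omega>0], intro conjI allI impI)
    show "\<omega>0 > 0"
      by (simp add: \<omega>0_def)
    fix \<omega> t0 x0 x y
    assume \<omega>: "\<omega> > \<omega>0" and t0: "(t0::real) \<ge> 0" and x: "is_solution (truncate (R + 1) (P \<omega>)) t0 x0 x"
      and y: "is_solution (\<lambda>t. G) t0 x0 y" and yR: "\<forall>t\<in>{t0..t0 + D}. norm (y t) \<le> R"
    have \<omega>1: "\<omega> \<ge> 1"
      using \<omega> by (simp add: \<omega>0_def)
    define \<kappa> where "\<kappa> = \<bar>C\<bar> / sqrt \<omega>"
    have "\<bar>C\<bar> * K / \<eta> < sqrt \<omega>"
      using \<omega> by (intro real_less_rsqrt) (simp add: \<omega>0_def)
    then have small: "\<kappa> * K < \<eta>"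
      using \<omega>1 assms by (simp add: \<kappa>_def field_simps)
    have C_le: "C / sqrt \<omega> \<le> \<kappa>"
      using \<omega>1 by (simp add: \<kappa>_def divide_right_mono)
    obtain Z where Z: "near_identity_map (P \<omega>) G (R + 1) (C / sqrt \<omega>) Z"
      using near \<omega>1 by blast
    then have
      Z1: "\<And>t x. t \<ge> 0 \<Longrightarrow> norm x \<le> R + 1 \<Longrightarrow> norm (Z t x) \<le> C / sqrt \<omega>" and
      Z2: "\<And>a t x. a \<ge> 0 \<Longrightarrow> t \<ge> a \<Longrightarrow> norm (x t) \<le> R + 1 \<Longrightarrow>
        (x has_vector_derivative P \<omega> t (x t)) (at t within {a..}) \<Longrightarrow>
        (\<exists>d. ((\<lambda>s. x s + Z s (x s)) has_vector_derivative d) (at t within {a..}) \<and>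
          norm (d - G (x t)) \<le> C / sqrt \<omega>)"
      unfolding near_identity_map_def by auto
    show "\<forall>t\<in>{t0..t0 + D}. norm (x t - y t) < \<eta>"
    proof
      fix t assume t: "t \<in> {t0..t0 + D}"
      show "norm (x t - y t) < \<eta>"
      proof (rule near_solutions_close[OF lip _ _ _ _ _ _ _ assms(2) t, where z = "\<lambda>s. x s + Z s (x s)"])
        fix s assume s: "s \<in> {t0..t0 + D}"
        show "(y has_vector_derivative G (y s)) (at s within {t0..t0 + D})"
          using is_solution_derivative_on[OF y order_refl s] .
        show "norm (y s) \<le> R"
          using yR s by blast
        assume xs: "norm (x s) \<le> R + 1"
        show "norm (x s + Z s (x s) - x s) \<le> \<kappa>"
          using Z1[OF _ xs] s t0 C_le by (simp, meson order_trans)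
        have "(x has_vector_derivative P \<omega> s (x s)) (at s within {t0..})"
          using x s xs by (auto simp: is_solution_def truncate_eq dest!: spec[of _ s])
        then obtain d where d: "((\<lambda>s. x s + Z s (x s)) has_vector_derivative d) (at s within {t0..})"
          "norm (d - G (x s)) \<le> C / sqrt \<omega>"
          using Z2[of t0 s x] t0 xs s by auto
        have "((\<lambda>s. x s + Z s (x s)) has_vector_derivative d) (at s within {t0..t0 + D})"
          using d(1) by (rule has_vector_derivative_within_subset) auto
        with d(2) C_le show "\<exists>d. ((\<lambda>s. x s + Z s (x s)) has_vector_derivative d) (at s within {t0..t0 + D}) \<and>
            norm (d - G (x s)) \<le> \<kappa>"
          by (meson order_trans)
      next
        show "continuous_on {t0..t0 + D} x"
          using is_solution_continuous_on[OF x] by (rule continuous_on_subset) auto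
        show "norm (x t0 - y t0) \<le> \<kappa>"
          using x y \<omega>1 by (simp add: is_solution_def \<kappa>_def)
        show "\<kappa> * (1 + (2 + (1 + L) * (t0 + D - t0)) * exp (L * (t0 + D - t0))) < \<eta>"
          using small by (simp add: K_def)
      qed
    qed
  qed
qed

text \<open>Attractivity says nothing about the transient. Continuous dependence gives each point of
  \<open>K\<close> a ball of initial values whose solutions stay within distance 1 of the solution
  from the centre, and finitely many such balls cover \<open>K\<close>.\<close>

lemma averaged_solutions_bounded:
  assumes K: "compact K" and sol: "\<And>x0. x0 \<in> K \<Longrightarrow> \<exists>y. is_solution (\<lambda>t. G) 0 x0 y"
    and D: "D \<ge> 0"
  shows "\<exists>R. \<forall>t0. \<forall>x0\<in>K. \<forall>y. is_solution (\<lambda>t. G) t0 x0 y \<longrightarrow> (\<forall>t\<in>{t0..t0 + D}. norm (y t) \<le> R)"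
proof -
  have "\<exists>r \<kappa>. \<kappa> > 0 \<and> (\<forall>x0\<in>ball k \<kappa>. \<forall>t0 x. is_solution (\<lambda>t. G) t0 x0 x \<longrightarrow>
      (\<forall>t\<in>{t0..t0 + D}. norm (x t) \<le> r))" if k: "k \<in> K" for k
  proof -
    obtain y where y: "is_solution (\<lambda>t. G) 0 k y"
      using sol k by blast
    have "compact (y ` {0..D})"
      by (intro compact_continuous_image continuous_on_subset[OF is_solution_continuous_on[OF y]]) auto
    then obtain R where R: "\<And>t. t \<in> {0..D} \<Longrightarrow> norm (y t) \<le> R"
      by (meson bounded_iff compact_imp_bounded imageI)
    obtain L where lip: "L-lipschitz_on (cball 0 (R + 1)) G"
      using G_lipschitz by blast
    then have L: "L \<ge> 0"
      by (rule lipschitz_on_nonneg)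
    define B where "B = 1 + (2 + (1 + L) * D) * exp (L * D)"
    have B: "B > 0"
      using L D by (auto simp: B_def intro!: add_pos_nonneg)
    define \<kappa> where "\<kappa> = 1 / (2 * B)"
    have \<kappa>: "\<kappa> > 0" "\<kappa> * B < 1"
      using B by (auto simp: \<kappa>_def)
    show ?thesis
    proof (rule exI[of _ "R + 1"], rule exI[of _ \<kappa>], intro conjI ballI allI impI)
      fix x0 t0 x t
      assume x0: "x0 \<in> ball k \<kappa>" and x: "is_solution (\<lambda>t. G) t0 x0 x" and t: "t \<in> {t0..t0 + D}"
      define y' where "y' t = y (t - t0 + 0)" for t
      have y': "is_solution (\<lambda>t. G) t0 k y'"
        unfolding y'_def by (rule is_solution_autonomous_shift[OF y])
      have y'_bound: "norm (y' s) \<le> R" if "s \<in> {t0..t0 + D}" for s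
        using that R[of "s - t0"] by (auto simp: y'_def)
      have "norm (x t - y' t) < 1"
      \<comment> \<open>With \<open>z = x\<close> the perturbation lemma reduces to continuous
        dependence on the initial value; the defect of the derivative is 0.\<close>
      proof (rule near_solutions_close[OF lip _ y'_bound _ _ _ _ _ order_refl t, where z = x and \<kappa> = \<kappa>])
        show "continuous_on {t0..t0 + D} x"
          using is_solution_continuous_on[OF x] by (rule continuous_on_subset) auto
        show "norm (x t0 - y' t0) \<le> \<kappa>"
          using x y' x0 by (simp add: is_solution_def dist_norm norm_minus_commute)
        show "\<kappa> * (1 + (2 + (1 + L) * (t0 + D - t0)) * exp (L * (t0 + D - t0))) < 1"
          using \<kappa>(2) by (simp add: B_def)
        fix s assume s: "s \<in> {t0..t0 + D}"
        show "(y' has_vector_derivative G (y' s)) (at s within {t0..t0 + D})"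
          using is_solution_derivative_on[OF y' order_refl s] .
        show "\<exists>d. (x has_vector_derivative d) (at s within {t0..t0 + D}) \<and> norm (d - G (x s)) \<le> \<kappa>"
          using is_solution_derivative_on[OF x order_refl s] \<kappa>(1) by (intro exI[of _ "G (x s)"]) auto
      qed (use \<kappa>(1) in auto)
      then show "norm (x t) \<le> R + 1"
        using y'_bound[OF t] norm_triangle_sub[of "x t" "y' t"] by auto
    qed (rule \<kappa>(1))
  qed
  then obtain r \<kappa> where \<kappa>: "\<And>k. k \<in> K \<Longrightarrow> \<kappa> k > 0"
    and r: "\<And>k x0 t0 x t. k \<in> K \<Longrightarrow> x0 \<in> ball k (\<kappa> k) \<Longrightarrow> is_solution (\<lambda>t. G) t0 x0 x \<Longrightarrow>
      t \<in> {t0..t0 + D} \<Longrightarrow> norm (x t) \<le> r k"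
    by metis
  obtain K' where K': "K' \<subseteq> K" "finite K'" "K \<subseteq> (\<Union>k\<in>K'. ball k (\<kappa> k))"
  proof (rule compactE_image[OF K, of K "\<lambda>k. ball k (\<kappa> k)"])
    show "K \<subseteq> (\<Union>k\<in>K. ball k (\<kappa> k))"
      using \<kappa> by force
  qed auto
  have "norm (x t) \<le> (\<Sum>k\<in>K'. \<bar>r k\<bar>)"
    if x0: "x0 \<in> K" and x: "is_solution (\<lambda>t. G) t0 x0 x" "t \<in> {t0..t0 + D}" for x0 t0 x t
  proof -
    obtain k where k: "k \<in> K'" "x0 \<in> ball k (\<kappa> k)"
      using K' x0 by blast
    then have "norm (x t) \<le> r k"
      using r K' x by blast
    also have "\<dots> \<le> \<bar>r k\<bar>"
      by simp
    also have "\<dots> \<le> (\<Sum>k\<in>K'. \<bar>r k\<bar>)"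
      using k K' by (intro member_le_sum) auto
    finally show ?thesis .
  qed
  then show ?thesis
    by blast
qed

text \<open>On each horizon of length \<open>D\<close> the truncated solution follows a solution of the averaged system,
  which at the end of the horizon is so close to \<open>S\<close> that the argument can be repeated.  The
  order of the quantifiers matters: the attraction argument chooses the radius after \<open>\<delta>\<close>.\<close>

lemma truncated_practically_stable:
  assumes R0: "nbhd 1 S \<subseteq> cball 0 R0"
    and stable: "uniformly_stable (\<lambda>t. G) S"
    and attractive: "\<delta>h > 0" "uniformly_attractive \<delta>h (\<lambda>t. G) S"
    and \<epsilon>: "0 < \<epsilon>" "\<epsilon> \<le> 1"
  shows "\<exists>\<delta>>0. \<forall>R\<ge>R0. \<exists>\<omega>0>0. \<forall>\<omega>>\<omega>0. \<forall>t0\<ge>0. \<forall>x0\<in>nbhd \<delta> S. \<forall>x.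
    is_solution (truncate (R + 1) (P \<omega>)) t0 x0 x \<longrightarrow> (\<forall>t\<ge>t0. x t \<in> nbhd \<epsilon> S)"
proof -
  obtain \<delta>1 where \<delta>1: "\<delta>1 > 0"
    "\<And>t0 x0. t0 \<ge> 0 \<Longrightarrow> x0 \<in> nbhd \<delta>1 S \<Longrightarrow> solution_stays (\<lambda>t. G) t0 x0 t0 (nbhd (\<epsilon>/2) S)"
    using stable \<epsilon>(1) unfolding uniformly_stable_def by (meson half_gt_zero)
  \<comment> \<open>Starting within \<delta> is covered by both properties of (G), so each horizon
    can use stability in between and attraction at its end.\<close>
  define \<delta> where "\<delta> = min \<delta>1 \<delta>h"
  have \<delta>: "\<delta> > 0"
    using \<delta>1 attractive by (simp add: \<delta>_def)
  obtain t1 where t1: "t1 \<ge> 0"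
    "\<And>t0 x0. t0 \<ge> 0 \<Longrightarrow> x0 \<in> nbhd \<delta>h S \<Longrightarrow> solution_stays (\<lambda>t. G) t0 x0 (t0 + t1) (nbhd (\<delta>/2) S)"
    using attractive(2) \<delta> unfolding uniformly_attractive_def by (meson half_gt_zero)
  \<comment> \<open>Attraction holds from \<open>t1\<close> on; the added 1 makes the horizon
    positive even for \<open>t1 = 0\<close>, so that the grid \<open>t0 + n * D\<close> exhausts the
    half-line.\<close>
  define D where "D = t1 + 1"
  have D: "D > 0"
    using t1 by (simp add: D_def)
  \<comment> \<open>Half of \<delta> restores the starting condition at the end of a horizon, half
    of \<epsilon> covers the times in between; the other halves are left to the averaged
    solution.\<close>
  define \<eta> where "\<eta> = min (\<delta>/2) (\<epsilon>/2)"
  have \<eta>: "0 < \<eta>" "\<eta> \<le> 1"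
    using \<delta> \<epsilon> by (auto simp: \<eta>_def)
  show ?thesis
  proof (rule exI[of _ \<delta>], intro conjI \<delta> allI impI)
    fix R assume R: "R \<ge> R0"
    obtain \<omega>0 where \<omega>0: "\<omega>0 > 0" and close: "\<And>\<omega> t0 x0 x y t. \<omega> > \<omega>0 \<Longrightarrow> t0 \<ge> 0 \<Longrightarrow>
        is_solution (truncate (R + 1) (P \<omega>)) t0 x0 x \<Longrightarrow> is_solution (\<lambda>t. G) t0 x0 y \<Longrightarrow>
        \<forall>t\<in>{t0..t0 + D}. norm (y t) \<le> R \<Longrightarrow> t \<in> {t0..t0 + D} \<Longrightarrow> norm (x t - y t) < \<eta>"
      using finite_horizon_close[OF \<eta> less_imp_le[OF D]] by meson
    have horizon: "x (s + D) \<in> nbhd \<delta> S \<and> (\<forall>t\<in>{s..s + D}. x t \<in> nbhd \<epsilon> S)"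
      if \<omega>: "\<omega> > \<omega>0" and s: "s \<ge> 0" and x: "is_solution (truncate (R + 1) (P \<omega>)) s (x s) x"
        and xs: "x s \<in> nbhd \<delta> S" for \<omega> s x
    proof -
      have xs1: "x s \<in> nbhd \<delta>1 S" and xsh: "x s \<in> nbhd \<delta>h S"
        using xs nbhd_mono[of \<delta> \<delta>1 S] nbhd_mono[of \<delta> \<delta>h S] by (auto simp: \<delta>_def)
      obtain y where y: "is_solution (\<lambda>t. G) s (x s) y" and y1: "\<And>t. t \<ge> s \<Longrightarrow> y t \<in> nbhd (\<epsilon>/2) S"
        using \<delta>1(2)[OF s xs1] unfolding solution_stays_def by blast
      have y2: "y (s + D) \<in> nbhd (\<delta>/2) S"
        using t1(2)[OF s xsh] y unfolding solution_stays_def by (simp add: D_def)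
      have "norm (y t) \<le> R" if "t \<in> {s..s + D}" for t
        using that y1[of t] nbhd_mono[of "\<epsilon>/2" 1 S] \<epsilon> R0 R by (auto dest!: subsetD)
      then have close_xy: "dist (x t) (y t) < \<eta>" if "t \<in> {s..s + D}" for t
        using close[OF \<omega> s x y] that by (simp add: dist_norm)
      have "x (s + D) \<in> nbhd (\<delta>/2 + \<delta>/2) S"
        using close_xy[of "s + D"] D by (intro nbhd_triangle[OF y2]) (auto simp: \<eta>_def)
      moreover have "x t \<in> nbhd (\<epsilon>/2 + \<epsilon>/2) S" if "t \<in> {s..s + D}" for t
        using close_xy[of t] that y1[of t] by (intro nbhd_triangle[of "y t"]) (auto simp: \<eta>_def)
      ultimately show ?thesis
        by simp
    qed
    show "\<exists>\<omega>0>0. \<forall>\<omega>>\<omega>0. \<forall>t0\<ge>0. \<forall>x0\<in>nbhd \<delta> S. \<forall>x.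
        is_solution (truncate (R + 1) (P \<omega>)) t0 x0 x \<longrightarrow> (\<forall>t\<ge>t0. x t \<in> nbhd \<epsilon> S)"
    proof (rule exI[of _ \<omega>0], intro conjI \<omega>0 allI impI ballI)
      fix \<omega> t0 x0 x t
      assume \<omega>: "\<omega> > \<omega>0" and t0: "(t0::real) \<ge> 0" and x0: "x0 \<in> nbhd \<delta> S"
        and x: "is_solution (truncate (R + 1) (P \<omega>)) t0 x0 x" and t: "t \<ge> t0"
      have restart: "is_solution (truncate (R + 1) (P \<omega>)) (t0 + real n * D) (x (t0 + real n * D)) x" for n
        using D by (intro is_solution_restart[OF x]) simp
      have grid: "x (t0 + real n * D) \<in> nbhd \<delta> S" for n
      proof (induction n)
        case 0
        then show ?case
          using x x0 by (simp add: is_solution_def)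
      next
        case (Suc n)
        then show ?case
          using horizon[OF \<omega> _ restart Suc] t0 D by (simp add: algebra_simps)
      qed
      define n where "n = nat \<lfloor>(t - t0) / D\<rfloor>"
      have "real n \<le> (t - t0) / D" "(t - t0) / D \<le> real n + 1"
        using t D by (auto simp: n_def intro!: less_imp_le[OF floor_less_iff[THEN iffD1]])
      then have "t \<in> {t0 + real n * D..t0 + real n * D + D}"
        using D by (simp add: field_simps)
      then show "x t \<in> nbhd \<epsilon> S"
        using horizon[OF \<omega> _ restart grid] t0 D by (meson add_nonneg_nonneg less_imp_le mult_nonneg_nonneg of_nat_0_le_iff)
    qed
  qed
qed

lemma practically_stable:
  assumes S: "bounded S" and stable: "uniformly_stable (\<lambda>t. G) S"
    and attractive: "\<delta>h > 0" "uniformly_attractive \<delta>h (\<lambda>t. G) S"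
  shows "practically_uniformly_stable P S"
  unfolding practically_uniformly_stable_def
proof (intro allI impI)
  fix \<epsilon> :: real assume "\<epsilon> > 0"
  \<comment> \<open>Capping at 1 puts the target neighbourhood inside the ball on which the
    truncation changes nothing.\<close>
  define \<epsilon>' where "\<epsilon>' = min \<epsilon> 1"
  have \<epsilon>': "0 < \<epsilon>'" "\<epsilon>' \<le> 1"
    using \<open>\<epsilon> > 0\<close> by (auto simp: \<epsilon>'_def)
  obtain R where "\<forall>x\<in>nbhd 1 S. norm x \<le> R"
    using bounded_nbhd[OF S] bounded_iff by metis
  \<comment> \<open>For empty \<open>S\<close> the number \<open>R\<close> could be negative, and
    the truncation needs a nonempty ball.\<close>
  then have R: "nbhd 1 S \<subseteq> cball 0 (max R 0)"
    by force
  obtain \<delta> \<omega>0 where \<delta>: "\<delta> > 0" and \<omega>0: "\<omega>0 > 0" and stays: "\<And>\<omega> t0 x0 x t. \<omega> > \<omega>0 \<Longrightarrow> t0 \<ge> 0 \<Longrightarrow>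
      x0 \<in> nbhd \<delta> S \<Longrightarrow> is_solution (truncate (max R 0 + 1) (P \<omega>)) t0 x0 x \<Longrightarrow> t \<ge> t0 \<Longrightarrow> x t \<in> nbhd \<epsilon>' S"
    using truncated_practically_stable[OF R stable attractive \<epsilon>'] by (metis order_refl)
  show "\<exists>\<delta>>0. \<exists>\<omega>0>0. \<forall>t0\<ge>0. \<forall>\<omega>>\<omega>0. \<forall>x0\<in>nbhd \<delta> S. solution_stays (P \<omega>) t0 x0 t0 (nbhd \<epsilon> S)"
  proof (rule exI[of _ \<delta>], rule conjI[OF \<delta>], rule exI[of _ \<omega>0], intro conjI \<omega>0 allI impI ballI)
    fix t0 \<omega> x0 assume t0: "(t0::real) \<ge> 0" and \<omega>: "\<omega> > \<omega>0" and x0: "x0 \<in> nbhd \<delta> S"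
    obtain x where x: "is_solution (truncate (max R 0 + 1) (P \<omega>)) t0 x0 x"
      using truncated_solution_exists[of \<omega> t0 "max R 0 + 1"] t0 \<omega> \<omega>0 by auto
    note stays = stays[OF \<omega> t0 x0 x]
    show "solution_stays (P \<omega>) t0 x0 t0 (nbhd \<epsilon> S)"
    proof (rule solution_stays_of_truncated[OF x])
      fix t assume "t \<ge> t0"
      then show "norm (x t) \<le> max R 0 + 1" "x t \<in> nbhd \<epsilon> S"
        using stays nbhd_mono[of \<epsilon>' 1 S] nbhd_mono[of \<epsilon>' \<epsilon> S] R \<epsilon>' by (force simp: \<epsilon>'_def)+
    qed (use t0 \<omega> \<omega>0 in auto)
  qed
qed

text \<open>Closeness on \<open>{t0..t0 + t1}\<close> brings the solution into the region of
  practical stability, which takes over from \<open>t0 + t1\<close> on. The boundedness hypothesis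
  is separate because local and global stability supply it in different ways.\<close>

lemma practically_attractive:
  assumes S: "bounded S" and stable: "uniformly_stable (\<lambda>t. G) S"
    and \<delta>h: "\<delta>h > 0" and attractive: "uniformly_attractive \<delta>h (\<lambda>t. G) S"
    and bounded: "\<And>D. D \<ge> 0 \<Longrightarrow> \<exists>R. \<forall>t0\<ge>0. \<forall>x0\<in>nbhd \<delta>h S. \<forall>y. is_solution (\<lambda>t. G) t0 x0 y \<longrightarrow>
      (\<forall>t\<in>{t0..t0 + D}. norm (y t) \<le> R)"
  shows "practically_uniformly_attractive \<delta>h P S"
  unfolding practically_uniformly_attractive_def
proof (intro allI impI)
  fix \<epsilon> :: real assume "\<epsilon> > 0"
  define \<epsilon>' where "\<epsilon>' = min \<epsilon> 1"
  have \<epsilon>': "0 < \<epsilon>'" "\<epsilon>' \<le> 1"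
    using \<open>\<epsilon> > 0\<close> by (auto simp: \<epsilon>'_def)
  obtain R0 where "\<forall>x\<in>nbhd 1 S. norm x \<le> R0"
    using bounded_nbhd[OF S] bounded_iff by metis
  then have R0: "nbhd 1 S \<subseteq> cball 0 R0"
    by force
  obtain \<delta> where \<delta>: "\<delta> > 0" and stays: "\<forall>R\<ge>R0. \<exists>\<omega>0>0. \<forall>\<omega>>\<omega>0. \<forall>t0\<ge>0. \<forall>x0\<in>nbhd \<delta> S. \<forall>x.
    is_solution (truncate (R + 1) (P \<omega>)) t0 x0 x \<longrightarrow> (\<forall>t\<ge>t0. x t \<in> nbhd \<epsilon>' S)"
    using truncated_practically_stable[OF R0 stable \<delta>h attractive \<epsilon>'] by blast
  obtain t1 where t1: "t1 \<ge> 0"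
    "\<And>t0 x0. t0 \<ge> 0 \<Longrightarrow> x0 \<in> nbhd \<delta>h S \<Longrightarrow> solution_stays (\<lambda>t. G) t0 x0 (t0 + t1) (nbhd (\<delta>/2) S)"
    using attractive \<delta> unfolding uniformly_attractive_def by (meson half_gt_zero)
  obtain R1 where R1: "\<And>t0 x0 y t. t0 \<ge> 0 \<Longrightarrow> x0 \<in> nbhd \<delta>h S \<Longrightarrow> is_solution (\<lambda>t. G) t0 x0 y \<Longrightarrow>
      t \<in> {t0..t0 + t1} \<Longrightarrow> norm (y t) \<le> R1"
    using bounded[OF t1(1)] by blast
  \<comment> \<open>\<open>R1\<close> bounds the transient up to \<open>t1\<close>, and
    \<open>t1\<close> was chosen from \<delta>.\<close>
  define R where "R = Max {R0, R1, 0}"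
  have R: "R \<ge> R0" "R \<ge> R1" "R \<ge> 0"
    by (auto simp: R_def)
  obtain \<omega>1 where \<omega>1: "\<omega>1 > 0" "\<And>\<omega> t0 x0 x t. \<omega> > \<omega>1 \<Longrightarrow> t0 \<ge> 0 \<Longrightarrow> x0 \<in> nbhd \<delta> S \<Longrightarrow>
      is_solution (truncate (R + 1) (P \<omega>)) t0 x0 x \<Longrightarrow> t \<ge> t0 \<Longrightarrow> x t \<in> nbhd \<epsilon>' S"
    using stays R(1) by meson
  have \<eta>: "0 < min (\<delta>/2) 1" "min (\<delta>/2) 1 \<le> 1"
    using \<delta> by auto
  obtain \<omega>2 where \<omega>2: "\<omega>2 > 0" "\<And>\<omega> t0 x0 x y t. \<omega> > \<omega>2 \<Longrightarrow> t0 \<ge> 0 \<Longrightarrow>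
      is_solution (truncate (R + 1) (P \<omega>)) t0 x0 x \<Longrightarrow> is_solution (\<lambda>t. G) t0 x0 y \<Longrightarrow>
      \<forall>t\<in>{t0..t0 + t1}. norm (y t) \<le> R \<Longrightarrow> t \<in> {t0..t0 + t1} \<Longrightarrow> norm (x t - y t) < min (\<delta>/2) 1"
    using finite_horizon_close[OF \<eta> t1(1)] by meson
  show "\<exists>t1\<ge>0. \<exists>\<omega>0>0. \<forall>t0\<ge>0. \<forall>\<omega>>\<omega>0. \<forall>x0\<in>nbhd \<delta>h S. solution_stays (P \<omega>) t0 x0 (t0 + t1) (nbhd \<epsilon> S)"
  proof (rule exI[of _ t1], rule conjI[OF t1(1)], rule exI[of _ "max \<omega>1 \<omega>2"], intro conjI allI impI ballI)
    fix t0 \<omega> x0 assume t0: "(t0::real) \<ge> 0" and \<omega>: "\<omega> > max \<omega>1 \<omega>2" and x0: "x0 \<in> nbhd \<delta>h S"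
    have \<omega>_pos: "\<omega> > 0"
      using \<omega> \<omega>1 by simp
    obtain x where x: "is_solution (truncate (R + 1) (P \<omega>)) t0 x0 x"
      using truncated_solution_exists[of \<omega> t0 "R + 1"] t0 \<omega>_pos R by auto
    obtain y where y: "is_solution (\<lambda>t. G) t0 x0 y" and y1: "\<And>t. t \<ge> t0 + t1 \<Longrightarrow> y t \<in> nbhd (\<delta>/2) S"
      using t1(2)[OF t0 x0] unfolding solution_stays_def by blast
    have yR: "\<forall>t\<in>{t0..t0 + t1}. norm (y t) \<le> R"
      using R1[OF t0 x0 y] R by force
    have close: "norm (x t - y t) < min (\<delta>/2) 1" if "t \<in> {t0..t0 + t1}" for t
      using \<omega>2(2)[OF _ t0 x y yR that] \<omega> by simp
    have "x (t0 + t1) \<in> nbhd (\<delta>/2 + \<delta>/2) S"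
      using close[of "t0 + t1"] t1 y1[of "t0 + t1"]
      by (intro nbhd_triangle[of "y (t0 + t1)"]) (auto simp: dist_norm)
    then have late: "x t \<in> nbhd \<epsilon>' S" if "t \<ge> t0 + t1" for t
      using \<omega>1(2)[OF _ _ _ is_solution_restart[OF x]] \<omega> t0 t1 that by simp
    show "solution_stays (P \<omega>) t0 x0 (t0 + t1) (nbhd \<epsilon> S)"
    proof (rule solution_stays_of_truncated[OF x \<omega>_pos t0])
      fix t
      show "x t \<in> nbhd \<epsilon> S" if "t \<ge> t0 + t1"
        using late[OF that] nbhd_mono[of \<epsilon>' \<epsilon> S] by (auto simp: \<epsilon>'_def)
      assume t: "t \<ge> t0"
      show "norm (x t) \<le> R + 1"
      proof (cases "t \<ge> t0 + t1")
        case True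
        then have "x t \<in> cball 0 R0"
          using late nbhd_mono[OF \<epsilon>'(2), of S] R0 by blast
        then show ?thesis
          using R by simp
      next
        case False
        then have "t \<in> {t0..t0 + t1}"
          using t by simp
        then show ?thesis
          using close[of t] yR norm_triangle_sub[of "x t" "y t"] by force
      qed
    qed (use t1 in simp)
  qed (use t1 \<omega>1 in auto)
qed

lemma locally_practically_stable:
  assumes S: "compact S" and stable: "locally_uniformly_asymptotically_stable (\<lambda>t. G) S"
  shows "locally_practically_uniformly_asymptotically_stable P S"
proof -
  have us: "uniformly_stable (\<lambda>t. G) S"
    using stable by (simp add: locally_uniformly_asymptotically_stable_def)
  obtain \<delta>h where \<delta>h: "\<delta>h > 0" "uniformly_attractive \<delta>h (\<lambda>t. G) S"
    using stable by (auto simp: locally_uniformly_asymptotically_stable_def)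
  obtain \<delta>1 where \<delta>1: "\<delta>1 > 0"
    "\<And>t0 x0. t0 \<ge> 0 \<Longrightarrow> x0 \<in> nbhd \<delta>1 S \<Longrightarrow> solution_stays (\<lambda>t. G) t0 x0 t0 (nbhd 1 S)"
    using us unfolding uniformly_stable_def by (meson zero_less_one)
  obtain R where R: "\<forall>x\<in>nbhd 1 S. norm x \<le> R"
    using bounded_nbhd[OF compact_imp_bounded[OF S]] bounded_iff by metis
  \<comment> \<open>Shrinking the radius of attraction to at most \<delta>1 lets stability confine
    the transient to \<open>nbhd 1 S\<close>.\<close>
  let ?\<delta> = "min \<delta>1 \<delta>h"
  have "practically_uniformly_attractive ?\<delta> P S"
  proof (rule practically_attractive[OF compact_imp_bounded[OF S] us])
    show "uniformly_attractive ?\<delta> (\<lambda>t. G) S"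
      using \<delta>h(2) nbhd_mono[of ?\<delta> \<delta>h S] unfolding uniformly_attractive_def by (meson min.cobounded2 subsetD)
    fix D :: real
    show "\<exists>R. \<forall>t0\<ge>0. \<forall>x0\<in>nbhd ?\<delta> S. \<forall>y. is_solution (\<lambda>t. G) t0 x0 y \<longrightarrow> (\<forall>t\<in>{t0..t0 + D}. norm (y t) \<le> R)"
      using \<delta>1(2) nbhd_mono[of ?\<delta> \<delta>1 S] R unfolding solution_stays_def
      by (intro exI[of _ R]) (meson atLeastAtMost_iff min.cobounded1 subsetD)
  qed (use \<delta>1 \<delta>h in auto)
  moreover have "?\<delta> > 0"
    using \<delta>1 \<delta>h by simp
  ultimately show ?thesis
    using practically_stable[OF compact_imp_bounded[OF S] us \<delta>h]
    unfolding locally_practically_uniformly_asymptotically_stable_def by blast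
qed

text \<open>For a large radius stability gives no bound on the transient, so compactness is used
  instead. Passing to the closure makes the set of initial values compact, and attraction with the
  enlarged radius \<open>\<delta> + 1\<close> supplies solutions there.\<close>

lemma semiglobally_practically_stable:
  assumes S: "compact S" and stable: "globally_uniformly_asymptotically_stable (\<lambda>t. G) S"
  shows "semiglobally_practically_uniformly_asymptotically_stable P S"
proof -
  have us: "uniformly_stable (\<lambda>t. G) S" and attr: "\<And>\<delta>. \<delta> > 0 \<Longrightarrow> uniformly_attractive \<delta> (\<lambda>t. G) S"
    using stable by (auto simp: globally_uniformly_asymptotically_stable_def)
  have "practically_uniformly_attractive \<delta> P S" if \<delta>: "\<delta> > 0" for \<delta>
  proof (rule practically_attractive[OF compact_imp_bounded[OF S] us \<delta> attr[OF \<delta>]])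
    fix D :: real assume D: "D \<ge> 0"
    have "\<exists>R. \<forall>t0. \<forall>x0\<in>closure (nbhd \<delta> S). \<forall>y. is_solution (\<lambda>t. G) t0 x0 y \<longrightarrow>
        (\<forall>t\<in>{t0..t0 + D}. norm (y t) \<le> R)"
    proof (rule averaged_solutions_bounded[OF _ _ D])
      show "compact (closure (nbhd \<delta> S))"
        using bounded_nbhd[OF compact_imp_bounded[OF S]] by simp
      fix x0 assume "x0 \<in> closure (nbhd \<delta> S)"
      then have x0: "x0 \<in> nbhd (\<delta> + 1) S"
        using closure_nbhd_subset[of \<delta> "\<delta> + 1" S] by auto
      have "uniformly_attractive (\<delta> + 1) (\<lambda>t. G) S"
        using attr \<delta> by simp
      then show "\<exists>y. is_solution (\<lambda>t. G) 0 x0 y"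
        using x0 unfolding uniformly_attractive_def solution_stays_def by (meson order_refl zero_less_one)
    qed
    then show "\<exists>R. \<forall>t0\<ge>0. \<forall>x0\<in>nbhd \<delta> S. \<forall>y. is_solution (\<lambda>t. G) t0 x0 y \<longrightarrow>
        (\<forall>t\<in>{t0..t0 + D}. norm (y t) \<le> R)"
      by (meson closure_subset subsetD)
  qed
  then show ?thesis
    using practically_stable[OF compact_imp_bounded[OF S] us zero_less_one attr[OF zero_less_one]]
    unfolding semiglobally_practically_uniformly_asymptotically_stable_def by blast
qed

end

section \<open>Averaging of highly oscillating control-affine systems\<close>

lemma periodic_bounded:
  fixes w :: "real \<Rightarrow> real"
  assumes cont: "continuous_on {0..} w" and "T > 0" and per: "\<And>t. t \<ge> 0 \<Longrightarrow> w (t + T) = w t"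
  shows "\<exists>C. \<forall>t\<ge>0. \<bar>w t\<bar> \<le> C"
proof -
  have iter: "w (t + real n * T) = w t" if "t \<ge> 0" for t n
  proof (induction n)
    case (Suc n)
    have "w (t + real (Suc n) * T) = w ((t + real n * T) + T)"
      by (simp add: algebra_simps)
    also have "\<dots> = w t"
      using per[of "t + real n * T"] that \<open>T > 0\<close> Suc by simp
    finally show ?case .
  qed simp
  have "compact (w ` {0..T})"
    by (intro compact_continuous_image continuous_on_subset[OF cont]) auto
  then obtain C where C: "\<And>t. t \<in> {0..T} \<Longrightarrow> \<bar>w t\<bar> \<le> C"
    by (metis bounded_iff compact_imp_bounded imageI real_norm_def)
  have "\<bar>w t\<bar> \<le> C" if "t \<ge> 0" for t
  proof -
    define n where "n = nat \<lfloor>t / T\<rfloor>"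
    have "real n \<le> t / T" "t / T \<le> real n + 1"
      using that \<open>T > 0\<close> by (auto simp: n_def intro!: less_imp_le[OF floor_less_iff[THEN iffD1]])
    then have "t - real n * T \<in> {0..T}"
      using \<open>T > 0\<close> by (simp add: field_simps)
    then show ?thesis
      using iter[of "t - real n * T" n] C[of "t - real n * T"] by simp
  qed
  then show ?thesis
    by blast
qed

lemma primitive_has_real_derivative:
  fixes v :: "real \<Rightarrow> real"
  assumes "continuous_on {0..} v" "t \<ge> 0"
  shows "((\<lambda>t. integral {0..t} v) has_real_derivative v t) (at t within {0..})"
  using integral_has_vector_derivative_half_line[OF assms]
  by (simp add: has_real_derivative_iff_has_vector_derivative)

text \<open>The difference of the two sides has derivative \<open>v (t + T) - v t = 0\<close>, and
  its value at 0 is the integral over one period.\<close>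

lemma primitive_periodic:
  fixes v :: "real \<Rightarrow> real"
  assumes cont: "continuous_on {0..} v" and "T > 0" and per: "\<And>t. t \<ge> 0 \<Longrightarrow> v (t + T) = v t"
    and mean: "integral {0..T} v = 0" and t: "t \<ge> 0"
  shows "integral {0..t + T} v = integral {0..t} v"
proof -
  have "((\<lambda>t. integral {0..t + T} v - integral {0..t} v) has_real_derivative 0) (at s within {0..})"
    if s: "s \<in> {0..}" for s
  proof -
    have "((\<lambda>t. integral {0..t} v) has_real_derivative v (s + T)) (at (s + T) within (\<lambda>t. t + T) ` {0..})"
      by (rule has_field_derivative_subset[OF primitive_has_real_derivative[OF cont]]) (use s \<open>T > 0\<close> in auto)
    then have "(((\<lambda>t. integral {0..t} v) \<circ> (\<lambda>t. t + T)) has_real_derivative v (s + T) * 1) (at s within {0..})"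
      by (rule DERIV_image_chain) (auto intro!: derivative_eq_intros)
    then show ?thesis
      using primitive_has_real_derivative[OF cont] s per[of s]
      by (auto intro!: derivative_eq_intros simp: o_def)
  qed
  then obtain c where "\<forall>t\<in>{0..}. integral {0..t + T} v - integral {0..t} v = c"
    using has_field_derivative_zero_constant[of "{0..}" "\<lambda>t. integral {0..t + T} v - integral {0..t} v"] by auto
  from this[rule_format, of 0] this[rule_format, of t] show ?thesis
    using mean t by simp
qed

lemma primitive_continuous:
  fixes v :: "real \<Rightarrow> real"
  assumes "continuous_on {0..} v"
  shows "continuous_on {0..} (\<lambda>t. integral {0..t} v)"
  using primitive_has_real_derivative[OF assms] by (intro DERIV_continuous_on[of "{0..}"]) auto

lemma primitive_rescaled_derivative:
  fixes v :: "real \<Rightarrow> real"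
  assumes cont: "continuous_on {0..} v" and "\<omega> > 0" "a \<ge> 0" "t \<ge> a"
  shows "((\<lambda>s. integral {0..\<omega> * s} v) has_real_derivative \<omega> * v (\<omega> * t)) (at t within {a..})"
proof -
  have "((\<lambda>t. integral {0..t} v) has_real_derivative v (\<omega> * t)) (at (\<omega> * t) within (*) \<omega> ` {a..})"
    by (rule has_field_derivative_subset[OF primitive_has_real_derivative[OF cont]]) (use assms in auto)
  then have "(((\<lambda>t. integral {0..t} v) \<circ> (*) \<omega>) has_real_derivative v (\<omega> * t) * \<omega>) (at t within {a..})"
    by (rule DERIV_image_chain) (auto intro!: derivative_eq_intros)
  then show ?thesis
    by (simp add: o_def mult.commute)
qed

section \<open>Uniform bounds and Lipschitz constants on balls\<close>

lemma finite_uniform_bound: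
  fixes h :: "'k \<Rightarrow> 'x \<Rightarrow> 'b::real_normed_vector"
  assumes "finite K" "\<And>k. k \<in> K \<Longrightarrow> \<exists>M. \<forall>x\<in>X. norm (h k x) \<le> M"
  shows "\<exists>M. \<forall>k\<in>K. \<forall>x\<in>X. norm (h k x) \<le> M"
proof -
  obtain m where m: "\<And>k x. k \<in> K \<Longrightarrow> x \<in> X \<Longrightarrow> norm (h k x) \<le> m k"
    using assms(2) by metis
  have "norm (h k x) \<le> (\<Sum>k\<in>K. \<bar>m k\<bar>)" if "k \<in> K" "x \<in> X" for k x
    using m[OF that] member_le_sum[of k K "\<lambda>k. \<bar>m k\<bar>"] assms(1) that by force
  then show ?thesis
    by blast
qed

lemma continuous_bounded_on_cball:
  fixes h :: "'a::euclidean_space \<Rightarrow> 'b::real_normed_vector"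
  assumes "continuous_on UNIV h"
  shows "\<exists>M. \<forall>x\<in>cball 0 R. norm (h x) \<le> M"
proof -
  have "compact (h ` cball 0 R)"
    by (intro compact_continuous_image continuous_on_subset[OF assms]) auto
  then show ?thesis
    by (metis bounded_iff compact_imp_bounded imageI)
qed

lemma C1_lipschitz_on_cball:
  fixes h :: "'a::euclidean_space \<Rightarrow> 'b::real_normed_vector"
  assumes "C1_map h"
  shows "\<exists>L. L-lipschitz_on (cball 0 R) h"
proof -
  obtain h' where h': "\<And>x. (h has_derivative blinfun_apply (h' x)) (at x)" "continuous_on UNIV h'"
    using assms unfolding C1_map_def by blast
  obtain M where M: "\<forall>x\<in>cball 0 R. norm (h' x) \<le> M"
    using continuous_bounded_on_cball[OF h'(2)] by blast
  have "\<bar>M\<bar>-lipschitz_on (cball 0 R) h"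
  proof (rule lipschitz_onI)
    fix x y :: 'a assume xy: "x \<in> cball 0 R" "y \<in> cball 0 R"
    show "dist (h x) (h y) \<le> \<bar>M\<bar> * dist x y"
      unfolding dist_norm
    proof (rule differentiable_bound[OF convex_cball _ _ xy])
      fix z assume z: "z \<in> cball (0::'a) R"
      show "(h has_derivative blinfun_apply (h' z)) (at z within cball 0 R)"
        using h'(1) by (rule has_derivative_at_withinI)
      show "onorm (blinfun_apply (h' z)) \<le> \<bar>M\<bar>"
        using M z by (fastforce simp flip: norm_blinfun.rep_eq)
    qed
  qed simp
  then show ?thesis
    by blast
qed

text \<open>The bounds \<open>m\<close> are kept apart from the coefficients \<open>c\<close> so
  that one Lipschitz constant serves all values of the oscillating coefficients.\<close>

lemma lipschitz_on_sum_scaleR: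
  fixes f :: "'k \<Rightarrow> 'a::metric_space \<Rightarrow> 'b::real_normed_vector"
  assumes lip: "\<And>k. k \<in> K \<Longrightarrow> (L k)-lipschitz_on X (f k)" and m: "\<And>k. k \<in> K \<Longrightarrow> \<bar>c k\<bar> \<le> m k"
  shows "(\<Sum>k\<in>K. m k * L k)-lipschitz_on X (\<lambda>x. \<Sum>k\<in>K. c k *\<^sub>R f k x)"
proof (rule lipschitz_onI)
  fix x y assume xy: "x \<in> X" "y \<in> X"
  have "dist (\<Sum>k\<in>K. c k *\<^sub>R f k x) (\<Sum>k\<in>K. c k *\<^sub>R f k y) = norm (\<Sum>k\<in>K. c k *\<^sub>R (f k x - f k y))"
    by (simp add: dist_norm scaleR_diff_right sum_subtractf)
  also have "\<dots> \<le> (\<Sum>k\<in>K. m k * (L k * dist x y))"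
  proof (rule sum_norm_le)
    fix k assume k: "k \<in> K"
    have "norm (c k *\<^sub>R (f k x - f k y)) = \<bar>c k\<bar> * dist (f k x) (f k y)"
      by (simp add: dist_norm)
    also have "\<dots> \<le> m k * (L k * dist x y)"
      using m[OF k] lipschitz_onD[OF lip[OF k] xy] by (intro mult_mono) auto
    finally show "norm (c k *\<^sub>R (f k x - f k y)) \<le> m k * (L k * dist x y)" .
  qed
  finally show "dist (\<Sum>k\<in>K. c k *\<^sub>R f k x) (\<Sum>k\<in>K. c k *\<^sub>R f k y) \<le> (\<Sum>k\<in>K. m k * L k) * dist x y"
    by (simp add: sum_distrib_right mult.assoc)
next
  show "0 \<le> (\<Sum>k\<in>K. m k * L k)"
    by (intro sum_nonneg mult_nonneg_nonneg order_trans[OF abs_ge_zero m] lipschitz_on_nonneg[OF lip])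
qed

text \<open>Second-order regularity is demanded of the products \<open>f' k x (f j x)\<close>, since
  these are what the change of variables differentiates. The abstract index set keeps the
  enumeration of the fields out of the estimates.\<close>

locale oscillating_inputs =
  fixes K :: "'k set" and f :: "'k \<Rightarrow> 'a::euclidean_space \<Rightarrow> 'a" and f' :: "'k \<Rightarrow> 'a \<Rightarrow> 'a \<Rightarrow>\<^sub>L 'a"
    and v :: "'k \<Rightarrow> real \<Rightarrow> real" and T :: real and \<beta> :: "'k \<Rightarrow> 'k \<Rightarrow> real"
  assumes finite_K: "finite K" and T_pos: "T > 0"
    and v_cont: "\<And>k. k \<in> K \<Longrightarrow> continuous_on {0..} (v k)"
    and v_periodic: "\<And>k t. k \<in> K \<Longrightarrow> v k (t + T) = v k t"
    and v_mean: "\<And>k. k \<in> K \<Longrightarrow> integral {0..T} (v k) = 0"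
    and f_derivative: "\<And>k x. k \<in> K \<Longrightarrow> (f k has_derivative blinfun_apply (f' k x)) (at x)"
    and f'_cont: "\<And>k. k \<in> K \<Longrightarrow> continuous_on UNIV (f' k)"
    and f'_f_C1: "\<And>j k. j \<in> K \<Longrightarrow> k \<in> K \<Longrightarrow> C1_map (\<lambda>x. blinfun_apply (f' k x) (f j x))"
    and \<beta>: "\<And>j k. j \<in> K \<Longrightarrow> k \<in> K \<Longrightarrow> integral {0..T} (\<lambda>\<theta>. v j \<theta> * integral {0..\<theta>} (v k)) = \<beta> j k * T"
begin

definition rhs :: "real \<Rightarrow> real \<Rightarrow> 'a \<Rightarrow> 'a" where
  "rhs \<omega> t x = (\<Sum>k\<in>K. (sqrt \<omega> * v k (\<omega> * t)) *\<^sub>R f k x)"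

definition g :: "'k \<Rightarrow> 'k \<Rightarrow> 'a \<Rightarrow> 'a" where
  "g j k x = blinfun_apply (f' k x) (f j x)"

text \<open>For antisymmetric \<beta> the pairs \<open>(j, k)\<close> and \<open>(k, j)\<close>
  combine to one Lie bracket, so this is the Lie bracket system freed of the ordering of the
  fields.\<close>

definition averaged :: "'a \<Rightarrow> 'a" where
  "averaged x = - (\<Sum>(j, k)\<in>K \<times> K. \<beta> j k *\<^sub>R g j k x)"

definition V :: "'k \<Rightarrow> real \<Rightarrow> real" where
  "V k t = integral {0..t} (v k)"

definition w :: "'k \<Rightarrow> 'k \<Rightarrow> real \<Rightarrow> real" where
  "w j k t = v j t * V k t - \<beta> j k"

definition W :: "'k \<Rightarrow> 'k \<Rightarrow> real \<Rightarrow> real" where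
  "W j k t = integral {0..t} (w j k)"

text \<open>\<open>V k\<close> removes the terms of order \<open>sqrt \<omega>\<close>, and \<open>W j k\<close> the oscillating terms of order one that
  this produces.\<close>

definition Z :: "real \<Rightarrow> real \<Rightarrow> 'a \<Rightarrow> 'a" where
  "Z \<omega> t x = (1 / \<omega>) *\<^sub>R (\<Sum>(j, k)\<in>K \<times> K. W j k (\<omega> * t) *\<^sub>R g j k x) - (1 / sqrt \<omega>) *\<^sub>R (\<Sum>k\<in>K. V k (\<omega> * t) *\<^sub>R f k x)"

lemma V_cont: "k \<in> K \<Longrightarrow> continuous_on {0..} (V k)"
  unfolding V_def by (intro primitive_continuous v_cont)

lemma V_periodic: "k \<in> K \<Longrightarrow> t \<ge> 0 \<Longrightarrow> V k (t + T) = V k t"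
  unfolding V_def by (intro primitive_periodic v_cont T_pos v_periodic v_mean)

lemma w_cont: "j \<in> K \<Longrightarrow> k \<in> K \<Longrightarrow> continuous_on {0..} (w j k)"
  unfolding w_def by (intro continuous_intros v_cont V_cont)

lemma w_periodic: "j \<in> K \<Longrightarrow> k \<in> K \<Longrightarrow> t \<ge> 0 \<Longrightarrow> w j k (t + T) = w j k t"
  by (simp add: w_def v_periodic V_periodic)

text \<open>Subtracting \<open>\<beta> j k\<close> removes exactly the mean; otherwise
  \<open>W j k\<close> would in general drift instead of being periodic and bounded.\<close>

lemma w_mean:
  assumes "j \<in> K" "k \<in> K"
  shows "integral {0..T} (w j k) = 0"
proof -
  have "(\<lambda>t. v j t * V k t) integrable_on {0..T}"
    using assms by (intro integrable_continuous_real continuous_intros continuous_on_subset[OF v_cont]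
      continuous_on_subset[OF V_cont]) auto
  then have "integral {0..T} (w j k) = integral {0..T} (\<lambda>t. v j t * V k t) - integral {0..T} (\<lambda>t. \<beta> j k)"
    unfolding w_def by (intro integral_diff) auto
  then show ?thesis
    using \<beta>[OF assms] T_pos by (simp add: V_def)
qed

lemma W_cont: "j \<in> K \<Longrightarrow> k \<in> K \<Longrightarrow> continuous_on {0..} (W j k)"
  unfolding W_def by (intro primitive_continuous w_cont)

lemma W_periodic: "j \<in> K \<Longrightarrow> k \<in> K \<Longrightarrow> t \<ge> 0 \<Longrightarrow> W j k (t + T) = W j k t"
  unfolding W_def by (intro primitive_periodic w_cont T_pos w_periodic w_mean)

lemma f_cont: "k \<in> K \<Longrightarrow> continuous_on UNIV (f k)"
  by (rule has_derivative_continuous_on) (rule has_derivative_at_withinI[OF f_derivative])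

lemma inputs_bounded: "\<exists>M. \<forall>k\<in>K. \<forall>t\<in>{0..}. norm (v k t) \<le> M"
proof (intro finite_uniform_bound finite_K)
  fix k assume "k \<in> K"
  then show "\<exists>M. \<forall>t\<in>{0..}. norm (v k t) \<le> M"
    using periodic_bounded[OF v_cont T_pos v_periodic] by (simp add: Ball_def)
qed

text \<open>The derivative of the \<open>V\<close> sum reproduces the whole right-hand side, of
  order \<open>sqrt \<omega>\<close>, and a double sum of order one that the \<open>W\<close> sum
  replaces by its mean. What remains is \<open>1 / \<omega>\<close> times \<open>g'\<close> applied
  to a velocity of order \<open>sqrt \<omega>\<close>.\<close>

lemma near_identity: "\<exists>C. \<forall>\<omega>\<ge>1. near_identity_map (rhs \<omega>) averaged R (C / sqrt \<omega>) (Z \<omega>)"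
proof -
  have "C1_map (g j k)" if "j \<in> K" "k \<in> K" for j k
    using f'_f_C1[OF that] by (simp add: g_def[abs_def])
  then obtain g' where g': "\<And>j k x. j \<in> K \<Longrightarrow> k \<in> K \<Longrightarrow> (g j k has_derivative blinfun_apply (g' j k x)) (at x)"
    and g'_cont: "\<And>j k. j \<in> K \<Longrightarrow> k \<in> K \<Longrightarrow> continuous_on UNIV (g' j k)"
    unfolding C1_map_def by metis
  have g_cont: "continuous_on UNIV (g j k)" if "j \<in> K" "k \<in> K" for j k
    by (rule has_derivative_continuous_on) (rule has_derivative_at_withinI[OF g'[OF that]])
  obtain M1 where M1: "\<forall>k\<in>K. \<forall>t\<in>{0..}. norm (v k t) \<le> M1"
    using inputs_bounded by blast
  have "\<exists>M. \<forall>k\<in>K. \<forall>t\<in>{0..}. norm (V k t) \<le> M"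
    using periodic_bounded[OF V_cont T_pos V_periodic]
    by (intro finite_uniform_bound finite_K) (simp add: Ball_def)
  then obtain M2 where M2: "\<forall>k\<in>K. \<forall>t\<in>{0..}. norm (V k t) \<le> M2"
    by blast
  have "\<exists>M. \<forall>p\<in>K \<times> K. \<forall>t\<in>{0..}. norm (W (fst p) (snd p) t) \<le> M"
    by (intro finite_uniform_bound finite_K finite_cartesian_product)
      (use periodic_bounded[OF W_cont T_pos W_periodic] in \<open>auto simp: Ball_def\<close>)
  then obtain M3 where M3: "\<forall>p\<in>K \<times> K. \<forall>t\<in>{0..}. norm (W (fst p) (snd p) t) \<le> M3"
    by blast
  have "\<exists>M. \<forall>k\<in>K. \<forall>x\<in>cball 0 R. norm (f k x) \<le> M"
    by (intro finite_uniform_bound finite_K continuous_bounded_on_cball f_cont)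
  then obtain M4 where M4: "\<forall>k\<in>K. \<forall>x\<in>cball 0 R. norm (f k x) \<le> M4"
    by blast
  have "\<exists>M. \<forall>p\<in>K \<times> K. \<forall>x\<in>cball 0 R. norm (g (fst p) (snd p) x) \<le> M"
    by (intro finite_uniform_bound finite_K finite_cartesian_product continuous_bounded_on_cball g_cont) auto
  then obtain M5 where M5: "\<forall>p\<in>K \<times> K. \<forall>x\<in>cball 0 R. norm (g (fst p) (snd p) x) \<le> M5"
    by blast
  have "\<exists>M. \<forall>p\<in>K \<times> K. \<forall>x\<in>cball 0 R. norm (g' (fst p) (snd p) x) \<le> M"
    by (intro finite_uniform_bound finite_K finite_cartesian_product continuous_bounded_on_cball g'_cont) auto
  then obtain M6 where M6: "\<forall>p\<in>K \<times> K. \<forall>x\<in>cball 0 R. norm (g' (fst p) (snd p) x) \<le> M6"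
    by blast
  define M where "M = \<bar>M1\<bar> + \<bar>M2\<bar> + \<bar>M3\<bar> + \<bar>M4\<bar> + \<bar>M5\<bar> + \<bar>M6\<bar>"
  have M: "0 \<le> M" "M1 \<le> M" "M2 \<le> M" "M3 \<le> M" "M4 \<le> M" "M5 \<le> M" "M6 \<le> M"
    by (auto simp: M_def)
  have v_le: "\<bar>v k t\<bar> \<le> M" and V_le: "\<bar>V k t\<bar> \<le> M" if "k \<in> K" "t \<ge> 0" for k t
    using M1 M2 M that by force+
  have W_le: "\<bar>W j k t\<bar> \<le> M" if "j \<in> K" "k \<in> K" "t \<ge> 0" for j k t
    using M3 M(4) that by force
  have f_le: "norm (f k x) \<le> M" if "k \<in> K" "norm x \<le> R" for k x
    using M4 M(5) that by force
  have g_le: "norm (g j k x) \<le> M" and g'_le: "norm (g' j k x) \<le> M" if "j \<in> K" "k \<in> K" "norm x \<le> R" for j k x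
    using M5 M6 M(6,7) that by force+
  define N where "N = real (card K)"
  have N: "0 \<le> N" "real (card (K \<times> K)) = N * N"
    by (simp_all add: N_def card_cartesian_product)
  \<comment> \<open>The first two summands bound \<open>Z\<close>, the third the remainder in the
    derivative, where the inner \<open>N * (M * M)\<close> comes from the velocity.\<close>
  define C where "C = N * N * (M * M) + N * (M * M) + N * N * (M * (M * (N * (M * M))))"
  have C1: "N * N * (M * M) + N * (M * M) \<le> C" and C2: "N * N * (M * (M * (N * (M * M)))) \<le> C"
    using N M by (auto simp: C_def)
  have "near_identity_map (rhs \<omega>) averaged R (C / sqrt \<omega>) (Z \<omega>)" if \<omega>: "\<omega> \<ge> 1" for \<omega>
  proof -
    define r where "r = sqrt \<omega>"
    have r: "r \<ge> 1" and r2: "\<omega> = r * r"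
      using \<omega> by (auto simp: r_def)
    have small: "norm (Z \<omega> t x) \<le> C / r" if t: "t \<ge> 0" and x: "norm x \<le> R" for t x
    proof -
      have \<omega>t: "\<omega> * t \<ge> 0"
        using t \<omega> by simp
      have 1: "norm (\<Sum>(j, k)\<in>K \<times> K. W j k (\<omega> * t) *\<^sub>R g j k x) \<le> N * N * (M * M)"
        unfolding N(2)[symmetric]
        by (rule sum_norm_bound) (auto intro!: mult_mono W_le[OF _ _ \<omega>t] g_le[OF _ _ x] M)
      have 2: "norm (\<Sum>k\<in>K. V k (\<omega> * t) *\<^sub>R f k x) \<le> N * (M * M)"
        unfolding N_def by (rule sum_norm_bound) (auto intro!: mult_mono V_le[OF _ \<omega>t] f_le[OF _ x] M)
      have "norm (Z \<omega> t x) \<le> 1 / \<omega> * (N * N * (M * M)) + 1 / r * (N * (M * M))"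
        unfolding Z_def r_def[symmetric] using r \<omega> 1 2
        by (intro order_trans[OF norm_triangle_ineq4] add_mono) (auto intro!: mult_left_mono divide_right_mono)
      also have "\<dots> \<le> 1 / r * (N * N * (M * M)) + 1 / r * (N * (M * M))"
      proof -
        have "1 / \<omega> \<le> 1 / r"
          using r by (simp add: r2 field_simps)
        then show ?thesis
          using N M by (intro add_right_mono mult_right_mono) auto
      qed
      also have "\<dots> = (N * N * (M * M) + N * (M * M)) / r"
        by (simp add: add_divide_distrib)
      also have "\<dots> \<le> C / r"
        using C1 r by (intro divide_right_mono) auto
      finally show ?thesis .
    qed
    have deriv: "\<exists>d. ((\<lambda>s. x s + Z \<omega> s (x s)) has_vector_derivative d) (at t within {a..}) \<and> norm (d - averaged (x t)) \<le> C / r"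
      if a: "a \<ge> 0" and t: "t \<ge> a" and xR: "norm (x t) \<le> R"
        and x: "(x has_vector_derivative rhs \<omega> t (x t)) (at t within {a..})" for a t x
    proof -
      define p where "p = rhs \<omega> t (x t)"
      define \<tau> where "\<tau> = \<omega> * t"
      have \<tau>: "\<tau> \<ge> 0"
        using a t \<omega> by (simp add: \<tau>_def)
      have p: "p = (\<Sum>k\<in>K. (r * v k \<tau>) *\<^sub>R f k (x t))"
        by (simp add: p_def rhs_def r_def \<tau>_def)
      have comp: "((\<lambda>s. h (x s)) has_vector_derivative h' p) (at t within {a..})"
        if "(h has_derivative h') (at (x t))" for h :: "'a \<Rightarrow> 'a" and h'
        using vector_derivative_diff_chain_within[OF x has_derivative_at_withinI[OF that]] by (simp add: o_def p_def)
      have dV: "((\<lambda>s. V k (\<omega> * s)) has_real_derivative \<omega> * v k \<tau>) (at t within {a..})" if "k \<in> K" for k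
        unfolding V_def \<tau>_def using that a t \<omega> by (intro primitive_rescaled_derivative v_cont) auto
      have dW: "((\<lambda>s. W j k (\<omega> * s)) has_real_derivative \<omega> * w j k \<tau>) (at t within {a..})" if "j \<in> K" "k \<in> K" for j k
        unfolding W_def \<tau>_def using that a t \<omega> by (intro primitive_rescaled_derivative w_cont) auto
      define A where "A = (\<Sum>(j, k)\<in>K \<times> K. W j k \<tau> *\<^sub>R g' j k (x t) p + (\<omega> * w j k \<tau>) *\<^sub>R g j k (x t))"
      define B where "B = (\<Sum>k\<in>K. V k \<tau> *\<^sub>R f' k (x t) p + (\<omega> * v k \<tau>) *\<^sub>R f k (x t))"
      have dA: "((\<lambda>s. \<Sum>(j, k)\<in>K \<times> K. W j k (\<omega> * s) *\<^sub>R g j k (x s)) has_vector_derivative A) (at t within {a..})"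
        unfolding A_def case_prod_unfold \<tau>_def
        by (rule has_vector_derivative_sum, rule has_vector_derivative_scaleR)
          (auto intro!: comp g' dW[unfolded \<tau>_def])
      have dB: "((\<lambda>s. \<Sum>k\<in>K. V k (\<omega> * s) *\<^sub>R f k (x s)) has_vector_derivative B) (at t within {a..})"
        unfolding B_def \<tau>_def
        by (rule has_vector_derivative_sum, rule has_vector_derivative_scaleR)
          (auto intro!: comp f_derivative dV[unfolded \<tau>_def])
      let ?d = "p + ((1 / \<omega>) *\<^sub>R A - (1 / sqrt \<omega>) *\<^sub>R B)"
      have d: "((\<lambda>s. x s + Z \<omega> s (x s)) has_vector_derivative ?d) (at t within {a..})"
        unfolding Z_def using x[folded p_def] dA dB
        by (intro has_vector_derivative_add has_vector_derivative_diff
          bounded_linear.has_vector_derivative[OF bounded_linear_scaleR_right])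
      have f'p: "f' k (x t) p = (\<Sum>j\<in>K. (r * v j \<tau>) *\<^sub>R g j k (x t))" for k
        unfolding p g_def by (simp add: blinfun.sum_right blinfun.scaleR_right)
      have "(1 / r) *\<^sub>R B = (\<Sum>k\<in>K. (\<Sum>j\<in>K. (V k \<tau> * v j \<tau>) *\<^sub>R g j k (x t)) + (r * v k \<tau>) *\<^sub>R f k (x t))"
        unfolding B_def scaleR_sum_right
      proof (rule sum.cong[OF refl])
        fix k assume "k \<in> K"
        have "(1 / r) *\<^sub>R V k \<tau> *\<^sub>R f' k (x t) p = (\<Sum>j\<in>K. (V k \<tau> * v j \<tau>) *\<^sub>R g j k (x t))"
          unfolding f'p scaleR_sum_right using r by (intro sum.cong) auto
        then show "(1 / r) *\<^sub>R (V k \<tau> *\<^sub>R f' k (x t) p + (\<omega> * v k \<tau>) *\<^sub>R f k (x t)) =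
            (\<Sum>j\<in>K. (V k \<tau> * v j \<tau>) *\<^sub>R g j k (x t)) + (r * v k \<tau>) *\<^sub>R f k (x t)"
          using r by (simp add: scaleR_add_right r2)
      qed
      \<comment> \<open>The last summand is the velocity itself; it cancels the \<open>p\<close> in
        \<open>?d\<close>.\<close>
      also have "\<dots> = (\<Sum>(j, k)\<in>K \<times> K. (v j \<tau> * V k \<tau>) *\<^sub>R g j k (x t)) + p"
        unfolding sum.distrib p[symmetric]
        by (subst sum.swap) (simp add: sum.cartesian_product mult.commute)
      finally have B: "(1 / r) *\<^sub>R B = (\<Sum>(j, k)\<in>K \<times> K. (v j \<tau> * V k \<tau>) *\<^sub>R g j k (x t)) + p" .
      have A: "(1 / \<omega>) *\<^sub>R A = (1 / \<omega>) *\<^sub>R (\<Sum>(j, k)\<in>K \<times> K. W j k \<tau> *\<^sub>R g' j k (x t) p)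
          + ((\<Sum>(j, k)\<in>K \<times> K. (v j \<tau> * V k \<tau>) *\<^sub>R g j k (x t)) + averaged (x t))"
        unfolding A_def averaged_def case_prod_unfold sum.distrib scaleR_add_right scaleR_sum_right
        using \<omega> by (simp add: w_def algebra_simps sum_subtractf)
      \<comment> \<open>The velocity is of order \<open>r\<close>, so dividing by
        \<open>\<omega> = r * r\<close> leaves one factor \<open>1 / r\<close>.\<close>
      have "norm p \<le> N * (r * M * M)"
        unfolding p N_def using r
        by (intro sum_norm_bound) (auto simp: abs_mult intro!: mult_mono v_le[OF _ \<tau>] f_le[OF _ xR] M)
      then have gp: "norm (g' j k (x t) p) \<le> M * (N * (r * M * M))" if "j \<in> K" "k \<in> K" for j k
        using g'_le[OF that xR] M by (intro order_trans[OF norm_blinfun] mult_mono) auto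
      have "norm (\<Sum>(j, k)\<in>K \<times> K. W j k \<tau> *\<^sub>R g' j k (x t) p) \<le> N * N * (M * (M * (N * (r * M * M))))"
        unfolding N(2)[symmetric]
        by (rule sum_norm_bound) (auto intro!: mult_mono W_le[OF _ _ \<tau>] gp M)
      then have "norm (?d - averaged (x t)) \<le> 1 / \<omega> * (N * N * (M * (M * (N * (r * M * M)))))"
        unfolding r_def[symmetric] A B using \<omega> by (simp add: divide_right_mono)
      also have "\<dots> = N * N * (M * (M * (N * (M * M)))) / r"
        using r by (simp add: r2 field_simps)
      also have "\<dots> \<le> C / r"
        using C2 r by (intro divide_right_mono) auto
      finally show ?thesis
        using d by blast
    qed
    show ?thesis
      unfolding near_identity_map_def r_def[symmetric] using small deriv by blast
  qed
  then show ?thesis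
    by blast
qed

sublocale averaging rhs averaged
proof
  fix R
  show "\<exists>L. L-lipschitz_on (cball 0 R) averaged"
  proof -
    have "\<exists>L. L-lipschitz_on (cball 0 R) (g j k)" if "j \<in> K" "k \<in> K" for j k
      using C1_lipschitz_on_cball[OF f'_f_C1[OF that]] by (simp add: g_def[abs_def])
    then obtain L where "\<And>j k. j \<in> K \<Longrightarrow> k \<in> K \<Longrightarrow> (L j k)-lipschitz_on (cball 0 R) (g j k)"
      by metis
    then have "(\<Sum>p\<in>K \<times> K. \<bar>- \<beta> (fst p) (snd p)\<bar> * L (fst p) (snd p))-lipschitz_on (cball 0 R)
        (\<lambda>x. \<Sum>p\<in>K \<times> K. (- \<beta> (fst p) (snd p)) *\<^sub>R g (fst p) (snd p) x)"
      by (intro lipschitz_on_sum_scaleR) auto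
    then show ?thesis
      by (auto simp: averaged_def[abs_def] case_prod_unfold sum_negf)
  qed
  show "\<exists>C. \<forall>\<omega>\<ge>1. \<exists>Z. near_identity_map (rhs \<omega>) averaged R (C / sqrt \<omega>) Z"
    using near_identity by meson
next
  fix \<omega> R :: real assume \<omega>: "\<omega> > 0"
  show "continuous_on {0..} (\<lambda>t. rhs \<omega> t x)" for x
    unfolding rhs_def using \<omega> by (intro continuous_intros continuous_on_compose2[OF v_cont]) auto
  obtain M where M: "\<forall>k\<in>K. \<forall>t\<in>{0..}. norm (v k t) \<le> M"
    using inputs_bounded by blast
  have le: "\<bar>sqrt \<omega> * v k (\<omega> * t)\<bar> \<le> sqrt \<omega> * M" if "t \<ge> 0" "k \<in> K" for t k
    using M that \<omega> by (auto simp: abs_mult)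
  have "C1_map (f k)" if "k \<in> K" for k
    unfolding C1_map_def using f_derivative[OF that] f'_cont[OF that] by blast
  then have "\<exists>L. L-lipschitz_on (cball 0 R) (f k)" if "k \<in> K" for k
    using that by (intro C1_lipschitz_on_cball)
  then obtain L where L: "\<And>k. k \<in> K \<Longrightarrow> (L k)-lipschitz_on (cball 0 R) (f k)"
    by metis
  have "(\<Sum>k\<in>K. (sqrt \<omega> * M) * L k)-lipschitz_on (cball 0 R) (rhs \<omega> t)" if "t \<ge> 0" for t
    unfolding rhs_def[abs_def] using le[OF that] L by (intro lipschitz_on_sum_scaleR) auto
  then show "\<exists>L. \<forall>t\<ge>0. L-lipschitz_on (cball 0 R) (rhs \<omega> t)"
    by blast
  have "norm (rhs \<omega> t 0) \<le> (\<Sum>k\<in>K. sqrt \<omega> * M * norm (f k 0))" if "t \<ge> 0" for t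
    unfolding rhs_def using le[OF that] by (intro sum_norm_le) (auto intro!: mult_right_mono)
  then show "\<exists>M. \<forall>t\<ge>0. norm (rhs \<omega> t 0) \<le> M"
    by blast
qed

end

section \<open>Continuously differentiable maps\<close>

lemma C1_map_continuous_on: "C1_map f \<Longrightarrow> continuous_on X f"
  unfolding C1_map_def
  by (auto intro!: continuous_at_imp_continuous_on intro: has_derivative_continuous)

lemma C2_map_imp_C1_map: "C2_map f \<Longrightarrow> C1_map f"
  unfolding C2_map_def C1_map_def[of f] using C1_map_continuous_on by blast

lemma C1_map_bounded_linear:
  assumes "bounded_linear L"
  shows "C1_map L"
  unfolding C1_map_def
  by (rule exI[of _ "\<lambda>x. Blinfun L"]) (simp add: bounded_linear_Blinfun_apply assms bounded_linear_imp_has_derivative)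

lemma C1_map_compose:
  assumes "C1_map f" "C1_map g"
  shows "C1_map (\<lambda>x. g (f x))"
proof -
  obtain f' where f': "\<And>x. (f has_derivative blinfun_apply (f' x)) (at x)" "continuous_on UNIV f'"
    using assms(1) unfolding C1_map_def by blast
  obtain g' where g': "\<And>x. (g has_derivative blinfun_apply (g' x)) (at x)" "continuous_on UNIV g'"
    using assms(2) unfolding C1_map_def by blast
  have "((\<lambda>x. g (f x)) has_derivative blinfun_apply (g' (f x) o\<^sub>L f' x)) (at x)" for x
    using has_derivative_compose[OF f'(1) g'(1)] by (simp add: blinfun_compose.rep_eq o_def)
  moreover have "continuous_on UNIV (\<lambda>x. g' (f x) o\<^sub>L f' x)"
    by (intro bounded_bilinear.continuous_on[OF bounded_bilinear_blinfun_compose] f'(2)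
      continuous_on_compose2[OF g'(2) C1_map_continuous_on[OF assms(1)]]) auto
  ultimately show ?thesis
    unfolding C1_map_def by (intro exI[of _ "\<lambda>x. g' (f x) o\<^sub>L f' x"]) blast
qed

lemma (in bounded_bilinear) C1_map_prod:
  assumes "C1_map f" "C1_map g"
  shows "C1_map (\<lambda>x. prod (f x) (g x))"
proof -
  obtain f' where f': "\<And>x. (f has_derivative blinfun_apply (f' x)) (at x)" "continuous_on UNIV f'"
    using assms(1) unfolding C1_map_def by blast
  obtain g' where g': "\<And>x. (g has_derivative blinfun_apply (g' x)) (at x)" "continuous_on UNIV g'"
    using assms(2) unfolding C1_map_def by blast
  let ?D = "\<lambda>x. (prod_right (f x) o\<^sub>L g' x) + (prod_left (g x) o\<^sub>L f' x)"
  have "((\<lambda>x. prod (f x) (g x)) has_derivative blinfun_apply (?D x)) (at x)" for x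
    using FDERIV[OF f'(1) g'(1)] by (simp add: blinfun_compose.rep_eq plus_blinfun.rep_eq)
  moreover have "continuous_on UNIV ?D"
    by (intro continuous_on_add bounded_bilinear.continuous_on[OF bounded_bilinear_blinfun_compose] f'(2) g'(2)
      bounded_linear.continuous_on[OF bounded_linear_prod_right]
      bounded_linear.continuous_on[OF bounded_linear_prod_left] C1_map_continuous_on assms)
  ultimately show ?thesis
    unfolding C1_map_def by (intro exI[of _ ?D]) blast
qed

lemma C1_map_real_derivative:
  fixes F :: "real \<Rightarrow> real"
  assumes "C1_map F"
  shows "(F has_real_derivative deriv F z) (at z)" and "continuous_on X (deriv F)"
proof -
  obtain F' where F': "\<And>x. (F has_derivative blinfun_apply (F' x)) (at x)" "continuous_on UNIV F'"
    using assms unfolding C1_map_def by blast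
  have "(F has_real_derivative blinfun_apply (F' x) 1) (at x)" for x
  proof -
    have "blinfun_apply (F' x) h = blinfun_apply (F' x) 1 * h" for h
      using blinfun.scaleR_right[of "F' x" h 1] by (metis mult.commute mult.right_neutral real_scaleR_def)
    then have "blinfun_apply (F' x) = (*) (blinfun_apply (F' x) 1)"
      by blast
    then show ?thesis
      using F'(1)[of x] unfolding has_field_derivative_def by argo
  qed
  moreover from this have "deriv F = (\<lambda>x. blinfun_apply (F' x) 1)"
    by (auto intro: DERIV_imp_deriv)
  ultimately show "(F has_real_derivative deriv F z) (at z)" and "continuous_on X (deriv F)"
    using continuous_on_subset[OF F'(2)] by (auto intro!: continuous_intros)
qed

lemma C2_map_real_derivative:
  fixes F :: "real \<Rightarrow> real"
  assumes "C2_map F"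
  shows "C1_map (deriv F)"
proof -
  obtain F' where F': "\<And>x. (F has_derivative blinfun_apply (F' x)) (at x)" "C1_map F'"
    using assms unfolding C2_map_def by blast
  have "deriv F x = blinfun_apply (F' x) 1" for x
  proof -
    have "(F has_derivative (*) (deriv F x)) (at x)"
      using C1_map_real_derivative(1)[OF C2_map_imp_C1_map[OF assms]] by (simp add: has_field_derivative_def)
    from has_derivative_unique[OF this F'(1)] show ?thesis
      by (metis mult.right_neutral)
  qed
  then have "deriv F = (\<lambda>x. blinfun_apply (F' x) 1)"
    by blast
  moreover have "bounded_linear (\<lambda>B. blinfun_apply B 1)"
    by (intro bounded_linear_intros)
  ultimately show ?thesis
    using C1_map_compose[OF F'(2) C1_map_bounded_linear[of "\<lambda>B. blinfun_apply B 1"]] by metis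
qed

section \<open>Lie brackets\<close>

text \<open>\<open>Lim\<close> has the intended meaning only if the limit exists, so convergence of
  the quotient has to be proved.\<close>

lemma lie_derivative_eq:
  assumes "(f has_derivative f') (at x)"
  shows "lie_derivative g f x = f' (g x)"
proof -
  let ?c = "\<lambda>s. f (x + s *\<^sub>R g x)"
  have "((\<lambda>s. x + s *\<^sub>R g x) has_derivative (\<lambda>s. s *\<^sub>R g x)) (at 0)"
    by (auto intro!: derivative_eq_intros)
  then have "(?c has_derivative (\<lambda>s. f' (s *\<^sub>R g x))) (at 0)"
    using has_derivative_compose[of "\<lambda>s. x + s *\<^sub>R g x" _ 0 UNIV f f'] assms by simp
  moreover have "f' (s *\<^sub>R g x) = s *\<^sub>R f' (g x)" for s
    using assms by (simp add: bounded_linear.linear has_derivative_bounded_linear linear_cmul)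
  ultimately have "((\<lambda>s. (?c s - f x - s *\<^sub>R f' (g x)) /\<^sub>R \<bar>s\<bar>) \<longlongrightarrow> 0) (at 0)"
    by (simp add: has_derivative_def)
  \<comment> \<open>Differentiability divides by \<open>\<bar>s\<bar>\<close>, the quotient by
    \<open>s\<close>; the two agree in norm, which suffices for convergence to 0.\<close>
  then have "((\<lambda>s. norm ((?c s - f x - s *\<^sub>R f' (g x)) /\<^sub>R \<bar>s\<bar>)) \<longlongrightarrow> 0) (at 0)"
    by (rule tendsto_norm_zero)
  also have "?this \<longleftrightarrow> ((\<lambda>s. norm ((?c s - f x) /\<^sub>R s - f' (g x))) \<longlongrightarrow> 0) (at 0)"
  proof (rule filterlim_cong[OF refl refl])
    show "\<forall>\<^sub>F s in at 0. norm ((?c s - f x - s *\<^sub>R f' (g x)) /\<^sub>R \<bar>s\<bar>) = norm ((?c s - f x) /\<^sub>R s - f' (g x))"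
      unfolding eventually_at_filter
    proof (intro always_eventually allI impI)
      fix s :: real assume s: "s \<noteq> 0"
      have "norm ((?c s - f x - s *\<^sub>R f' (g x)) /\<^sub>R \<bar>s\<bar>) = norm ((?c s - f x - s *\<^sub>R f' (g x)) /\<^sub>R s)"
        by simp
      also have "(?c s - f x - s *\<^sub>R f' (g x)) /\<^sub>R s = (?c s - f x) /\<^sub>R s - f' (g x)"
        using s by (simp add: scaleR_diff_right)
      finally show "norm ((?c s - f x - s *\<^sub>R f' (g x)) /\<^sub>R \<bar>s\<bar>) = norm ((?c s - f x) /\<^sub>R s - f' (g x))" .
    qed
  qed
  finally have "((\<lambda>s. (?c s - f x) /\<^sub>R s) \<longlongrightarrow> f' (g x)) (at 0)"
    by (rule LIM_zero_cancel[OF tendsto_norm_zero_cancel])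
  then show ?thesis
    unfolding lie_derivative_def by (intro tendsto_Lim) auto
qed

lemma lie_bracket_eq:
  assumes "(f has_derivative f') (at x)" "(g has_derivative g') (at x)"
  shows "lie_bracket f g x = g' (f x) - f' (g x)"
  by (simp add: lie_bracket_def lie_derivative_eq[OF assms(1)] lie_derivative_eq[OF assms(2)])

text \<open>Replaces the triangle, which depends on the enumeration, by half the full square, which
  does not.\<close>

lemma sum_symmetric_triangle:
  fixes H :: "nat \<Rightarrow> nat \<Rightarrow> 'a::real_vector"
  assumes sym: "\<And>i j. H i j = H j i" and diag: "\<And>i. H i i = 0"
  shows "2 *\<^sub>R (\<Sum>j=1..l. \<Sum>i\<in>{1..<j}. H j i) = (\<Sum>j=1..l. \<Sum>i=1..l. H j i)"
proof (induction l)
  case (Suc l)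
  have "(\<Sum>j=1..Suc l. \<Sum>i=1..Suc l. H j i) = (\<Sum>j=1..l. \<Sum>i=1..l. H j i) + (\<Sum>i=1..l. H i (Suc l)) + (\<Sum>i=1..l. H (Suc l) i)"
    by (simp add: sum.distrib diag)
  also have "(\<Sum>i=1..l. H i (Suc l)) = (\<Sum>i=1..l. H (Suc l) i)"
    by (rule sum.cong[OF refl]) (rule sym)
  finally show ?case
    using Suc by (simp add: scaleR_add_right scaleR_2 atLeastLessThanSuc_atLeastAtMost algebra_simps)
qed simp

text \<open>Both the bracket and \<beta> change sign when their arguments are exchanged, so their
  product is symmetric, and the result is the same for every enumeration \<sigma>.\<close>

lemma lie_bracket_system_eq:
  fixes f :: "'k \<Rightarrow> 'a::real_normed_vector \<Rightarrow> 'a"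
  assumes \<sigma>: "bij_betw \<sigma> {1..l} K"
    and deriv: "\<And>k. k \<in> K \<Longrightarrow> (f k has_derivative f' k) (at x)"
    and \<beta>: "\<And>j k. j \<in> K \<Longrightarrow> k \<in> K \<Longrightarrow> input_correlation T (v j) (v k) = \<beta> j k"
    and anti: "\<And>j k. j \<in> K \<Longrightarrow> k \<in> K \<Longrightarrow> \<beta> k j = - \<beta> j k"
  shows "lie_bracket_system T l (\<lambda>x. 0) (\<lambda>n. f (\<sigma> n)) (\<lambda>n. v (\<sigma> n)) x = - (\<Sum>(j, k)\<in>K \<times> K. \<beta> j k *\<^sub>R f' k (f j x))"
proof -
  define A where "A j k = \<beta> j k *\<^sub>R f' k (f j x)" for j k
  have \<sigma>_in: "\<sigma> n \<in> K" if "n \<in> {1..l}" for n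
    using \<sigma> that by (auto simp: bij_betw_def)
  \<comment> \<open>The default 0 outside \<open>K\<close> is there because symmetry is demanded for
    all natural indices, while \<sigma> is controlled only on \<open>{1..l}\<close>.\<close>
  define B where "B a b = (if a \<in> K \<and> b \<in> K then - A a b - A b a else 0)" for a b
  have term_eq: "input_correlation T (v a) (v b) *\<^sub>R lie_bracket (f b) (f a) x = B a b" if "a \<in> K" "b \<in> K" for a b
    using that by (simp add: \<beta> lie_bracket_eq[OF deriv deriv] B_def A_def anti[of a b] algebra_simps)
  have B_diag: "B a a = 0" for a
  proof (cases "a \<in> K")
    case True
    then have "\<beta> a a = 0"
      using anti[of a a] by simp
    then show ?thesis
      by (simp add: B_def A_def)
  qed (simp add: B_def)
  have "lie_bracket_system T l (\<lambda>x. 0) (\<lambda>n. f (\<sigma> n)) (\<lambda>n. v (\<sigma> n)) x = (\<Sum>j=1..l. \<Sum>i\<in>{1..<j}. B (\<sigma> j) (\<sigma> i))"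
    unfolding lie_bracket_system_def add_0
    by (intro sum.cong refl term_eq \<sigma>_in) auto
  also have "2 *\<^sub>R \<dots> = (\<Sum>j=1..l. \<Sum>i=1..l. B (\<sigma> j) (\<sigma> i))"
    by (rule sum_symmetric_triangle) (auto simp: B_diag, simp add: B_def)
  also have "\<dots> = (\<Sum>j=1..l. \<Sum>b\<in>K. B (\<sigma> j) b)"
    by (intro sum.cong refl sum.reindex_bij_betw[OF \<sigma>])
  also have "\<dots> = (\<Sum>a\<in>K. \<Sum>b\<in>K. B a b)"
    by (rule sum.reindex_bij_betw[OF \<sigma>])
  also have "\<dots> = (\<Sum>a\<in>K. \<Sum>b\<in>K. - A a b) + (\<Sum>a\<in>K. \<Sum>b\<in>K. - A b a)"
    by (simp add: B_def sum.distrib[symmetric])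
  also have "(\<Sum>a\<in>K. \<Sum>b\<in>K. - A b a) = (\<Sum>a\<in>K. \<Sum>b\<in>K. - A a b)"
    by (rule sum.swap)
  finally have "2 *\<^sub>R lie_bracket_system T l (\<lambda>x. 0) (\<lambda>n. f (\<sigma> n)) (\<lambda>n. v (\<sigma> n)) x =
      2 *\<^sub>R (\<Sum>a\<in>K. \<Sum>b\<in>K. - A a b)"
    by (simp only: scaleR_2)
  then have "lie_bracket_system T l (\<lambda>x. 0) (\<lambda>n. f (\<sigma> n)) (\<lambda>n. v (\<sigma> n)) x = (\<Sum>a\<in>K. \<Sum>b\<in>K. - A a b)"
    by (rule scaleR_left_imp_eq[rotated]) simp
  then show ?thesis
    by (simp add: A_def sum_negf sum.cartesian_product)
qed

text \<open>Integrating the derivative of the product of the primitives leaves only boundary terms,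
  which vanish because the primitive of \<open>v\<close> is 0 at both ends.\<close>

lemma primitive_product_antisymmetric:
  fixes v w :: "real \<Rightarrow> real"
  assumes v: "continuous_on {0..} v" "integral {0..T} v = 0" and w: "continuous_on {0..} w" and T: "T \<ge> 0"
  shows "integral {0..T} (\<lambda>t. v t * integral {0..t} w) = - integral {0..T} (\<lambda>t. w t * integral {0..t} v)"
proof -
  let ?V = "\<lambda>t. integral {0..t} v" and ?W = "\<lambda>t. integral {0..t} w"
  have "((\<lambda>t. v t * ?W t + w t * ?V t) has_integral ?V T * ?W T - ?V 0 * ?W 0) {0..T}"
  proof (rule fundamental_theorem_of_calculus[OF T])
    fix t assume t: "t \<in> {0..T}"
    have "(?V has_real_derivative v t) (at t within {0..T})" "(?W has_real_derivative w t) (at t within {0..T})"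
      using t by (auto intro!: has_field_derivative_subset[OF primitive_has_real_derivative] v w)
    then show "((\<lambda>t. ?V t * ?W t) has_vector_derivative v t * ?W t + w t * ?V t) (at t within {0..T})"
      unfolding has_real_derivative_iff_has_vector_derivative[symmetric]
      by (auto intro!: derivative_eq_intros)
  qed
  moreover have "(\<lambda>t. v t * ?W t) integrable_on {0..T}" "(\<lambda>t. w t * ?V t) integrable_on {0..T}"
    by (auto intro!: integrable_continuous_real continuous_intros continuous_on_subset[OF v(1)] continuous_on_subset[OF w]
      continuous_on_subset[OF primitive_continuous[OF v(1)]] continuous_on_subset[OF primitive_continuous[OF w]])
  ultimately have "integral {0..T} (\<lambda>t. v t * ?W t) + integral {0..T} (\<lambda>t. w t * ?V t) = 0"
    using v(2) by (simp add: integral_add[symmetric] integral_unique)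
  then show ?thesis
    by simp
qed

text \<open>Away from the zeros of \<open>F1\<close> this is the quotient rule for \<open>F2 / F1\<close>; at a zero both sides are continuous.\<close>

lemma integral_relation_wronskian:
  assumes rel: "integral_relation F0 F1 F2" and F1: "C1_map F1" and F2: "C1_map F2"
    and F0: "\<And>z. F1 z = 0 \<Longrightarrow> isCont F0 z"
  shows "F0 z = deriv F1 z * F2 z - deriv F2 z * F1 z"
proof -
  define H where "H z = deriv F1 z * F2 z - deriv F2 z * F1 z" for z
  obtain \<Psi> where \<Psi>: "\<And>z. F1 z \<noteq> 0 \<Longrightarrow> (\<Psi> has_real_derivative F0 z / (F1 z)\<^sup>2) (at z)"
    and F2_eq: "\<And>z. F1 z \<noteq> 0 \<Longrightarrow> F2 z = - F1 z * \<Psi> z"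
    using rel unfolding integral_relation_def Let_def by auto
  have "discrete {z. F1 z = 0}"
    using rel unfolding integral_relation_def Let_def by blast
  have "open {z. F1 z \<noteq> 0}"
    using C1_map_continuous_on[OF F1] by (intro open_Collect_neq) auto
  have away: "F0 z = H z" if z: "F1 z \<noteq> 0" for z
  proof -
    have "((\<lambda>z. - F1 z * \<Psi> z) has_real_derivative - deriv F1 z * \<Psi> z - F1 z * (F0 z / (F1 z)\<^sup>2)) (at z)"
      using C1_map_real_derivative(1)[OF F1, of z] \<Psi>[OF z] by (auto intro!: derivative_eq_intros)
    then have "(F2 has_real_derivative - deriv F1 z * \<Psi> z - F1 z * (F0 z / (F1 z)\<^sup>2)) (at z)"
      by (rule has_field_derivative_transform_within_open[OF _ \<open>open {z. F1 z \<noteq> 0}\<close>]) (use z F2_eq in auto)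
    then have "deriv F2 z = - deriv F1 z * \<Psi> z - F1 z * (F0 z / (F1 z)\<^sup>2)"
      by (rule DERIV_imp_deriv)
    then show ?thesis
      using z by (simp add: H_def F2_eq[OF z] power2_eq_square field_simps)
  qed
  show ?thesis
  proof (cases "F1 z = 0")
    case True
    \<comment> \<open>Zeros are isolated, so the formula holds in a punctured neighbourhood.
      Continuity of \<open>F0\<close> then carries it to \<open>z\<close>, where the integral
      relation says nothing about \<open>F0\<close>.\<close>
    have "\<forall>\<^sub>F y in at z. F1 y \<noteq> 0"
      using \<open>discrete {z. F1 z = 0}\<close> True unfolding discrete_altdef by auto
    then have "\<forall>\<^sub>F y in at z. F0 y = H y"
      by (rule eventually_mono) (rule away)
    moreover have "(F0 \<longlongrightarrow> F0 z) (at z)"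
      using F0[OF True] by (simp add: isCont_def)
    ultimately have "(H \<longlongrightarrow> F0 z) (at z)"
      by (rule Lim_transform_eventually[rotated])
    moreover have "continuous_on UNIV H"
      unfolding H_def by (intro continuous_intros C1_map_real_derivative(2) C1_map_continuous_on F1 F2)
    then have "(H \<longlongrightarrow> H z) (at z)"
      by (simp add: continuous_on_def)
    ultimately have "F0 z = H z"
      by (rule tendsto_unique[OF at_neq_bot])
    then show ?thesis
      by (simp add: H_def)
  qed (simp add: away H_def)
qed

text \<open>\<open>\<beta>_cross\<close> removes the brackets between fields of different
  coordinates, which would contribute mixed terms absent from (G). \<open>F0_cont\<close> determines
  \<open>F 0 i\<close> at the zeros of \<open>F 1 i\<close>, where (G) may evaluate it.\<close>

theorem theorem2:
  fixes J :: "real^'n \<Rightarrow> real"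
    and F :: "nat \<Rightarrow> 'n \<Rightarrow> real \<Rightarrow> real"
    and u :: "nat \<Rightarrow> 'n \<Rightarrow> real \<Rightarrow> real"
    and T :: real
    and \<beta> :: "nat \<Rightarrow> 'n \<Rightarrow> nat \<Rightarrow> 'n \<Rightarrow> real"
    and \<sigma> :: "nat \<Rightarrow> nat \<times> 'n"
  assumes J: "C2_map J"
    and F_C1: "\<forall>s\<in>{1,2}. \<forall>i. C1_map (F s i)"
    and F_rel: "\<forall>i. integral_relation (F 0 i) (F 1 i) (F 2 i)"
    and F0_cont: "\<forall>i z. F 1 i z = 0 \<longrightarrow> isCont (F 0 i) z"
    and T: "T > 0"
    and u_cont: "\<forall>s\<in>{1,2}. \<forall>i. continuous_on UNIV (u s i)"
    and u_periodic: "\<forall>s\<in>{1,2}. \<forall>i t. u s i (t + T) = u s i t"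
    and u_mean: "\<forall>s\<in>{1,2}. \<forall>i. integral {0..T} (u s i) = 0"
    and \<beta>: "\<forall>s\<in>{1,2}. \<forall>p\<in>{1,2}. \<forall>i j.
      integral {0..T} (\<lambda>\<theta>. integral {0..\<theta>} (\<lambda>\<tau>. u s i \<theta> * u p j \<tau>)) = \<beta> s i p j * T"
    and \<beta>_cross: "\<forall>s\<in>{1,2}. \<forall>p\<in>{1,2}. \<forall>i j. i \<noteq> j \<longrightarrow> \<beta> s i p j = 0"
    and \<sigma>: "bij_betw \<sigma> {1..2 * CARD('n)} ({1,2} \<times> UNIV)"
  shows "lie_bracket_system T (2 * CARD('n)) (\<lambda>x. 0)
           (\<lambda>k x. case \<sigma> k of (s, i) \<Rightarrow> F s i (J x) *\<^sub>R axis i 1)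
           (\<lambda>k. case \<sigma> k of (s, i) \<Rightarrow> u s i)
         = gradient_like_system J (F 0) (\<lambda>i. \<beta> 2 i 1 i)
       \<and> ((\<forall>s\<in>{1,2}. \<forall>i. C2_map (F s i)) \<longrightarrow>
           (\<forall>S. compact S \<longrightarrow>
             (locally_uniformly_asymptotically_stable
                (\<lambda>t. gradient_like_system J (F 0) (\<lambda>i. \<beta> 2 i 1 i)) S \<longrightarrow>
              locally_practically_uniformly_asymptotically_stable
                (extremum_seeking_system J F u) S) \<and>
             (globally_uniformly_asymptotically_stable
                (\<lambda>t. gradient_like_system J (F 0) (\<lambda>i. \<beta> 2 i 1 i)) S \<longrightarrow>
              semiglobally_practically_uniformly_asymptotically_stable
                (extremum_seeking_system J F u) S)))"
proof -
  define K :: "(nat \<times> 'n) set" where "K = {1,2} \<times> UNIV"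
  define f where "f = (\<lambda>(s, i) x. F s i (J x) *\<^sub>R axis i (1::real))"
  define v where "v = (\<lambda>(s, i). u s i)"
  define b where "b = (\<lambda>(s, i) (p, j). \<beta> s i p j)"
  obtain J' where J': "\<And>x. (J has_derivative blinfun_apply (J' x)) (at x)" "C1_map J'"
    using J unfolding C2_map_def by blast
  have J_C1: "C1_map J"
    using C2_map_imp_C1_map[OF J] .
  define f' where "f' = (\<lambda>(s, i) x. deriv (F s i) (J x) *\<^sub>R (blinfun_scaleR_left (axis i (1::real)) o\<^sub>L J' x))"
  have f'_apply: "blinfun_apply (f' (s, i) x) h = (deriv (F s i) (J x) * J' x h) *\<^sub>R axis i 1" for s i x h
    by (simp add: f'_def scaleR_blinfun.rep_eq blinfun_compose.rep_eq)
  have f_deriv: "(f k has_derivative blinfun_apply (f' k x)) (at x)" if k: "k \<in> K" for k x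
  proof -
    obtain s i where si: "k = (s, i)" "s \<in> {1,2}"
      using k by (auto simp: K_def)
    have "((\<lambda>x. F s i (J x)) has_derivative (\<lambda>h. deriv (F s i) (J x) * J' x h)) (at x)"
      using C1_map_real_derivative(1)[of "F s i" "J x"] F_C1 si(2)
      by (intro has_derivative_compose[OF J'(1)]) (auto simp: has_field_derivative_def)
    from has_derivative_scaleR_left[OF this] show ?thesis
      unfolding si(1) f'_apply[abs_def] f_def by simp
  qed
  have v_cont: "continuous_on X (v k)" and v_mean: "integral {0..T} (v k) = 0" and v_periodic: "v k (t + T) = v k t"
    if "k \<in> K" for k t X
    using that u_cont u_mean u_periodic by (auto simp: K_def v_def intro: continuous_on_subset)
  have b_corr: "integral {0..T} (\<lambda>\<theta>. integral {0..\<theta>} (\<lambda>\<tau>. v j \<theta> * v k \<tau>)) = b j k * T" if "j \<in> K" "k \<in> K" for j k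
    using that \<beta> by (auto simp: K_def v_def b_def)
  then have b_eq: "integral {0..T} (\<lambda>\<theta>. v j \<theta> * integral {0..\<theta>} (v k)) = b j k * T" if "j \<in> K" "k \<in> K" for j k
    using that by simp
  have b_anti: "b k j = - b j k" if "j \<in> K" "k \<in> K" for j k
  proof -
    have "b k j * T = - (b j k * T)"
      using that T by (subst (1 2) b_eq[symmetric]) (auto intro!: primitive_product_antisymmetric v_cont v_mean)
    then have "b k j * T = (- b j k) * T"
      by simp
    then show ?thesis
      using T by (metis mult_right_cancel less_irrefl)
  qed
  have partial: "partial_deriv i J x = J' x (axis i 1)" for i x
  proof -
    have "((\<lambda>s. x + s *\<^sub>R axis i 1) has_derivative (\<lambda>s. s *\<^sub>R axis i 1)) (at (0::real))"
      by (auto intro!: derivative_eq_intros)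
    then have "((\<lambda>s. J (x + s *\<^sub>R axis i 1)) has_derivative (\<lambda>s. J' x (s *\<^sub>R axis i 1))) (at 0)"
      using has_derivative_compose[of "\<lambda>s. x + s *\<^sub>R axis i 1" _ 0 UNIV J] J'(1)[of x] by simp
    then have "((\<lambda>s. J (x + s *\<^sub>R axis i 1)) has_real_derivative J' x (axis i 1)) (at 0)"
      by (simp add: has_field_derivative_def blinfun.scaleR_right mult_commute_abs)
    then show ?thesis
      unfolding partial_deriv_def by (rule DERIV_imp_deriv)
  qed
  have averaged_eq: "- (\<Sum>(j, k)\<in>K \<times> K. b j k *\<^sub>R blinfun_apply (f' k x) (f j x)) =
      gradient_like_system J (F 0) (\<lambda>i. \<beta> 2 i 1 i) x" for x
  proof -
    define c where "c p j s i = b (p, j) (s, i) *\<^sub>R blinfun_apply (f' (s, i) x) (f (p, j) x)" for p j s i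
    have c_eq: "c p i s i = (\<beta> p i s i * (deriv (F s i) (J x) * partial_deriv i J x * F p i (J x))) *\<^sub>R axis i 1" for p i s
      by (simp add: c_def b_def f'_apply f_def blinfun.scaleR_right partial)
    have c_cross: "c p j s i = 0" if "i \<noteq> j" "p \<in> {1,2}" "s \<in> {1,2}" for p j s i
      using that \<beta>_cross by (auto simp: c_def b_def)
    have "(\<Sum>(j, k)\<in>K \<times> K. b j k *\<^sub>R blinfun_apply (f' k x) (f j x)) =
        (\<Sum>p\<in>{1,2}. \<Sum>j\<in>UNIV. \<Sum>s\<in>{1,2}. \<Sum>i\<in>UNIV. c p j s i)"
      by (simp add: c_def K_def sum.cartesian_product' split_beta)
    also have "\<dots> = (\<Sum>p\<in>{1,2}. \<Sum>j\<in>UNIV. \<Sum>s\<in>{1,2}. c p j s j)"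
    proof (intro sum.cong refl)
      fix p s :: nat and j :: 'n assume "p \<in> {1,2}" "s \<in> {1,2}"
      then have "(\<Sum>i\<in>UNIV. c p j s i) = (\<Sum>i\<in>UNIV. if i = j then c p j s j else 0)"
        using c_cross by (intro sum.cong) auto
      then show "(\<Sum>i\<in>UNIV. c p j s i) = c p j s j"
        by simp
    qed
    also have "\<dots> = (\<Sum>j\<in>UNIV. c 1 j 1 j + c 1 j 2 j + (c 2 j 1 j + c 2 j 2 j))"
      by (simp add: sum.distrib)
    also have "\<dots> = (\<Sum>i\<in>UNIV. (\<beta> 2 i 1 i * partial_deriv i J x * F 0 i (J x)) *\<^sub>R axis i 1)"
    proof (rule sum.cong[OF refl])
      fix i
      have K: "(1, i) \<in> K" "(2, i) \<in> K"
        by (auto simp: K_def)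
      \<comment> \<open>Antisymmetry kills the terms with \<open>p = s\<close> and gives the two
        mixed terms opposite signs, so that the combination \<open>F1' * F2 - F2' * F1\<close>
        appears, which is \<open>F0\<close>.\<close>
      have \<beta>0: "\<beta> 1 i 1 i = 0" "\<beta> 2 i 2 i = 0" "\<beta> 1 i 2 i = - \<beta> 2 i 1 i"
        using b_anti[OF K(1) K(1)] b_anti[OF K(2) K(2)] b_anti[OF K(2) K(1)] by (auto simp: b_def)
      have F0: "F 0 i (J x) = deriv (F 1 i) (J x) * F 2 i (J x) - deriv (F 2 i) (J x) * F 1 i (J x)"
        using F_rel F_C1 F0_cont by (intro integral_relation_wronskian) auto
      show "c 1 i 1 i + c 1 i 2 i + (c 2 i 1 i + c 2 i 2 i) = (\<beta> 2 i 1 i * partial_deriv i J x * F 0 i (J x)) *\<^sub>R axis i 1"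
        unfolding c_eq \<beta>0 F0 by (simp add: algebra_simps flip: scaleR_add_left scaleR_diff_left)
    qed
    finally show ?thesis
      by (simp add: gradient_like_system_def)
  qed
  have bracket: "lie_bracket_system T (2 * CARD('n)) (\<lambda>x. 0)
           (\<lambda>k x. case \<sigma> k of (s, i) \<Rightarrow> F s i (J x) *\<^sub>R axis i 1)
           (\<lambda>k. case \<sigma> k of (s, i) \<Rightarrow> u s i)
         = gradient_like_system J (F 0) (\<lambda>i. \<beta> 2 i 1 i)"
  proof
    fix x
    have "lie_bracket_system T (2 * CARD('n)) (\<lambda>x. 0) (\<lambda>n. f (\<sigma> n)) (\<lambda>n. v (\<sigma> n)) x
        = - (\<Sum>(j, k)\<in>K \<times> K. b j k *\<^sub>R blinfun_apply (f' k x) (f j x))"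
    proof (rule lie_bracket_system_eq)
      show "bij_betw \<sigma> {1..2 * CARD('n)} K"
        using \<sigma> by (simp add: K_def)
      show "input_correlation T (v j) (v k) = b j k" if "j \<in> K" "k \<in> K" for j k
        using b_corr[OF that] T by (simp add: input_correlation_def)
    qed (fact f_deriv b_anti)+
    moreover have "(\<lambda>n. f (\<sigma> n)) = (\<lambda>k x. case \<sigma> k of (s, i) \<Rightarrow> F s i (J x) *\<^sub>R axis i 1)"
      by (auto simp: f_def fun_eq_iff split: prod.split)
    ultimately show "lie_bracket_system T (2 * CARD('n)) (\<lambda>x. 0)
           (\<lambda>k x. case \<sigma> k of (s, i) \<Rightarrow> F s i (J x) *\<^sub>R axis i 1)
           (\<lambda>k. case \<sigma> k of (s, i) \<Rightarrow> u s i) x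
         = gradient_like_system J (F 0) (\<lambda>i. \<beta> 2 i 1 i) x"
      by (simp add: averaged_eq v_def)
  qed
  have stability: "(locally_uniformly_asymptotically_stable
                (\<lambda>t. gradient_like_system J (F 0) (\<lambda>i. \<beta> 2 i 1 i)) S \<longrightarrow>
              locally_practically_uniformly_asymptotically_stable
                (extremum_seeking_system J F u) S) \<and>
             (globally_uniformly_asymptotically_stable
                (\<lambda>t. gradient_like_system J (F 0) (\<lambda>i. \<beta> 2 i 1 i)) S \<longrightarrow>
              semiglobally_practically_uniformly_asymptotically_stable
                (extremum_seeking_system J F u) S)"
    if F_C2: "\<forall>s\<in>{1,2}. \<forall>i. C2_map (F s i)" and S: "compact S" for S
  proof -
    have bl: "bounded_linear (\<lambda>B. blinfun_apply B h)" for h :: "real^'n"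
      by (intro bounded_linear_intros)
    interpret avg: oscillating_inputs K f f' v T b
    proof
      show "finite K"
        by (simp add: K_def)
      show "T > 0"
        by (rule T)
      fix k assume k: "k \<in> K"
      then obtain s i where si: "k = (s, i)" "s \<in> {1,2}"
        by (auto simp: K_def)
      show "continuous_on {0..} (v k)" "integral {0..T} (v k) = 0"
        using v_cont v_mean k by auto
      show "v k (t + T) = v k t" for t
        using v_periodic k by auto
      show "(f k has_derivative blinfun_apply (f' k x)) (at x)" for x
        by (rule f_deriv[OF k])
      have C1_F': "C1_map (\<lambda>x. deriv (F s i) (J x))"
        using F_C2 si by (intro C1_map_compose[OF J_C1] C2_map_real_derivative) auto
      show "continuous_on UNIV (f' k)"
        unfolding si(1) f'_def prod.case
        by (intro continuous_on_scaleR C1_map_continuous_on[OF C1_F'] continuous_on_const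
          bounded_bilinear.continuous_on[OF bounded_bilinear_blinfun_compose] C1_map_continuous_on[OF J'(2)])
      fix j assume j: "j \<in> K"
      then obtain p i' where pi: "j = (p, i')" "p \<in> {1,2}"
        by (auto simp: K_def)
      \<comment> \<open>All fields are scalar functions times fixed unit vectors, so only a scalar
        product of functions has to be C1. It contains \<open>deriv (F s i)\<close> and
        \<open>J'\<close>, hence the C2 hypotheses on \<open>F\<close> and \<open>J\<close>.\<close>
      have eq: "blinfun_apply (f' k x) (f j x) =
          (deriv (F s i) (J x) * (blinfun_apply (J' x) (axis i' 1) * F p i' (J x))) *\<^sub>R axis i 1" for x
        unfolding si(1) pi(1) f'_apply by (simp add: f_def blinfun.scaleR_right)
      have "C1_map (\<lambda>x. deriv (F s i) (J x) * (blinfun_apply (J' x) (axis i' 1) * F p i' (J x)))"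
        using F_C1 pi
        by (intro bounded_bilinear.C1_map_prod[OF bounded_bilinear_mult] C1_F'
          C1_map_compose[OF J'(2) C1_map_bounded_linear[OF bl]] C1_map_compose[OF J_C1]) auto
      then show "C1_map (\<lambda>x. blinfun_apply (f' k x) (f j x))"
        unfolding eq by (rule C1_map_compose) (rule C1_map_bounded_linear[OF bounded_linear_scaleR_left])
      show "integral {0..T} (\<lambda>\<theta>. v j \<theta> * integral {0..\<theta>} (v k)) = b j k * T"
        by (rule b_eq[OF j k])
    qed
    have averaged: "avg.averaged = gradient_like_system J (F 0) (\<lambda>i. \<beta> 2 i 1 i)"
      by (rule ext) (simp add: avg.averaged_def avg.g_def averaged_eq)
    have rhs: "avg.rhs = extremum_seeking_system J F u"
      unfolding fun_eq_iff avg.rhs_def extremum_seeking_system_def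
      by (simp add: K_def sum.cartesian_product' f_def v_def sum.distrib scaleR_add_left mult_ac)
    show ?thesis
      using avg.locally_practically_stable[OF S] avg.semiglobally_practically_stable[OF S]
      unfolding averaged rhs by blast
  qed
  show ?thesis
    using bracket stability by blast
qed

end
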